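(* Let $A$ be a finite set, $\Omega=A^{\mathbb{Z}}$ with Borel $\sigma$-algebra $\mathcal{F}$, $T$ the left shift, and $\mu\in\Delta(\Omega)$ stationary. Let $\mathcal{D}$ be a shift-invariant $\sigma$-algebra of Borel subsets of $\Omega$ with $\mathcal{D}\subseteq\mathcal{F}_{-\infty}^0$. Then the decomposition $(\Theta,\mathcal{B},\lambda,(\mu_\theta))$ of $\mu$ induced by $\mathcal{D}$ is weakly learnable: for $\lambda$-almost every $\theta$, for $\mu_\theta$-almost every $\omega=(\dots,a_{-1},a_0,a_1,\dots)$, $$\bigl\|\mu(\zeta_n=\cdot\mid \zeta_0=a_0,\dots,\zeta_{n-1}=a_{n-1})-\mu_\theta(\zeta_n=\cdot\mid \zeta_0=a_0,\dots,\zeta_{n-1}=a_{n-1})\bigr\|$$ strongly Cesaro converges to $0$ as $n\to\infty$.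
   Context: $\zeta_n:\Omega\to A$ is the $n$-th coordinate, $T(\omega)_n=\omega_{n+1}$. For $-\infty\le m<k\le\infty$, $\mathcal{F}_m^k$ is the $\sigma$-algebra generated by $\zeta_j$, $m\le j<k$; so $\mathcal{F}_{-\infty}^0$ is generated by $(\zeta_j)_{j<0}$. A $\sigma$-algebra $\mathcal{D}$ is shift-invariant if $S\in\mathcal{D}\iff T(S)\in\mathcal{D}$ for every Borel $S$. The decomposition induced by $\mathcal{D}$: let $(\Theta,\mathcal{B},\lambda)$ with measurable $\alpha:\Omega\to\Theta$ be the quotient of $(\Omega,\mathcal{F},\mu)$ by $\mathcal{D}$ (a standard probability space such that $\mathcal{D}$ is generated by $\alpha$ up to $\mu$-null sets, $\lambda=\alpha_*\mu$), and $(\mu_\theta)_{\theta\in\Theta}$ the conditional distributions of $\mu$ given $\mathcal{D}$: $\mu_\theta(\{\omega:\alpha(\omega)=\theta\})=1$, $\theta\mapsto\mu_\theta(S)$ is measurable, and $\mu(S)=\int\mu_\theta(S)\,\lambda(\mathrm d\theta)$ for all $S\in\mathcal{F}$. For $p,q\in\Delta(A)$, $\|p-q\|=\max_{a}|p[a]-q[a]|$. A bounded sequence $x_n$ strongly Cesaro converges to $x$ if $\frac1N\sum_{n<N}|x_n-x|\to0$. *)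

theory Defs
  imports "HOL-Probability.Probability"
begin

text \<open>The shift space Omega = A^Z with its Borel (= product) sigma-algebra.\<close>
definition shift_space :: "(int \<Rightarrow> 'a) measure" where
  "shift_space = Pi\<^sub>M UNIV (\<lambda>_. count_space UNIV)"

definition lshift :: "(int \<Rightarrow> 'a) \<Rightarrow> (int \<Rightarrow> 'a)" where
  "lshift \<omega> = (\<lambda>n. \<omega> (n + 1))"

definition past_sets :: "(int \<Rightarrow> 'a) set set" where
  "past_sets = sigma_sets (space shift_space)
      {{\<omega> \<in> space shift_space. \<omega> j = a} | j a. j < 0}"

text \<open>Conditional probability mu(zeta_n = a | zeta_0 = omega_0, ..., zeta_{n-1} = omega_{n-1})
  (with the HOL convention x / 0 = 0 on conditioning events of measure zero).\<close>
definition cond_next :: "(int \<Rightarrow> 'a) measure \<Rightarrow> (int \<Rightarrow> 'a) \<Rightarrow> nat \<Rightarrow> 'a \<Rightarrow> real" where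
  "cond_next M \<omega> n a =
     measure M {x \<in> space M. (\<forall>i<n. x (int i) = \<omega> (int i)) \<and> x (int n) = a}
     / measure M {x \<in> space M. \<forall>i<n. x (int i) = \<omega> (int i)}"

definition pred_dist :: "(int \<Rightarrow> 'a::finite) measure \<Rightarrow> (int \<Rightarrow> 'a) measure \<Rightarrow> (int \<Rightarrow> 'a) \<Rightarrow> nat \<Rightarrow> real" where
  "pred_dist M N \<omega> n = Max ((\<lambda>a. \<bar>cond_next M \<omega> n a - cond_next N \<omega> n a\<bar>) ` UNIV)"

definition strong_cesaro :: "(nat \<Rightarrow> real) \<Rightarrow> real \<Rightarrow> bool" where
  "strong_cesaro x L \<longleftrightarrow> (\<lambda>N. (\<Sum>n<N. \<bar>x n - L\<bar>) / real N) \<longlonglongrightarrow> 0"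

end

theory Submission
  imports Defs
begin

text \<open>
  Let $f$ be the indicator of $\zeta_0 = a$, and let $h = E(f \mid \mathcal{F}_{-\infty}^0)$ and
  $e_n = E(f \mid \mathcal{F}_{-n}^0 \vee \mathcal{D})$. By stationarity of $\mu$ and shift invariance of
  $\mathcal{D}$, the prediction of $\mu_{\alpha(\omega)}$ for $\zeta_n = a$ given $\zeta_0, \dots, \zeta_{n-1}$
  is almost surely $e_n(T^n \omega)$. As $\mathcal{D} \subseteq \mathcal{F}_{-\infty}^0$, Levy's upward theorem
  gives $e_n \to h$, and Maker's generalisation of the ergodic theorem turns this into strong Cesaro
  convergence of $e_n(T^n \omega) - h(T^n \omega)$ to $0$. For trivial $\mathcal{D}$ the same statement concerns
  the predictions of $\mu$ itself. Both predictions track the same sequence $h(T^n \omega)$, hence each other.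

  For Maker's theorem with limit $0$ the maximal ergodic inequality suffices: it is applied to
  $\sup_{n \ge k} |e_n - h|$, whose integral tends to $0$.
\<close>

section \<open>Maximal ergodic inequality\<close>

text \<open>The measures \<mu>_\<theta> need not be stationary: the shift maps D onto itself as a
  family but may move its individual sets, and with them the fibres of \<alpha>. So no ergodic
  theorem is applied under a fixed \<mu>_\<theta>. The whole comparison is made under \<mu>, with
  the random parameter \<alpha>(\<omega>) in place of \<theta>; a \<mu>-null exceptional set is then
  null for \<lambda>-almost every \<mu>_\<theta>, and since \<mu>_\<theta> lives on the fibre over
  \<theta>, the random parameter becomes the fixed one.

  The n-th term of the average reads a different function e_n at the n-th point of the orbit, so it
  is not a Birkhoff average of one function. Almost everywhere convergence of e_n is what makes the
  tail suprema of |e_n - h| have small integrals.\<close>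

text \<open>Maximal inequalities bound the measure of an exceptional set, and this turns such bounds
  into almost sure statements: with exceptional sets of measure at most 1/(j+1), their intersection
  is null, and off it some exceptional set is avoided.\<close>

lemma (in finite_measure) AE_by_small_exceptions:
  assumes "\<And>\<delta>::real. \<delta> > 0 \<Longrightarrow> \<exists>A\<in>sets M. measure M A \<le> \<delta> \<and> (AE x in M. x \<notin> A \<longrightarrow> P x)"
  shows "AE x in M. P x"
proof -
  have "\<exists>A\<in>sets M. measure M A \<le> inverse (real (Suc j)) \<and> (AE x in M. x \<notin> A \<longrightarrow> P x)" for j
    by (intro assms) simp
  then obtain A where A: "\<And>j. A j \<in> sets M" "\<And>j. measure M (A j) \<le> inverse (real (Suc j))"
    "\<And>j. AE x in M. x \<notin> A j \<longrightarrow> P x" by metis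
  have meas: "(\<Inter>j. A j) \<in> sets M" using A(1) by auto
  have "measure M (\<Inter>j. A j) \<le> inverse (real (Suc j))" for j
    using finite_measure_mono[of "\<Inter>j. A j" "A j"] A(1,2)[of j] by (meson INT_lower UNIV_I order_trans)
  then have "measure M (\<Inter>j. A j) \<le> 0"
    by (intro LIMSEQ_le_const[OF LIMSEQ_inverse_real_of_nat]) auto
  then have "AE x in M. x \<notin> (\<Inter>j. A j)"
    using meas by (intro AE_not_in) (simp add: null_sets_def emeasure_eq_measure measure_le_0_iff)
  moreover have "AE x in M. \<forall>j. x \<notin> A j \<longrightarrow> P x" unfolding AE_all_countable using A(3) by blast
  ultimately show ?thesis by eventually_elim auto
qed

text \<open>Since the maximum of $0$ and the Birkhoff sums $S_1, \dots, S_n$ of $g$ satisfies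
  $m_{n+1} = \max(0, g + m_n \circ T)$, this recursion is Garsia's maximal function.\<close>

primrec garsia :: "('a \<Rightarrow> 'a) \<Rightarrow> ('a \<Rightarrow> real) \<Rightarrow> nat \<Rightarrow> 'a \<Rightarrow> real" where
  "garsia T g 0 = (\<lambda>_. 0)"
| "garsia T g (Suc n) = (\<lambda>x. max 0 (g x + garsia T g n (T x)))"

lemma garsia_nonneg: "0 \<le> garsia T g n x"
  by (cases n) auto

lemma garsia_le_Suc: "garsia T g n x \<le> garsia T g (Suc n) x"
proof (induction n arbitrary: x)
  case (Suc n)
  from Suc[of "T x"] show ?case by simp
qed simp

lemma birkhoff_sum_le_garsia:
  "k \<le> n \<Longrightarrow> (\<Sum>i<k. g ((T ^^ i) x)) \<le> garsia T g n x"
proof (induction n arbitrary: k x)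
  case (Suc n)
  show ?case
  proof (cases k)
    case 0
    then show ?thesis by (simp only: lessThan_0 sum.empty garsia_nonneg)
  next
    case [simp]: (Suc l)
    have "(\<Sum>i<k. g ((T ^^ i) x)) = g x + (\<Sum>i<l. g ((T ^^ i) (T x)))"
      by (simp add: sum.lessThan_Suc_shift funpow_swap1 del: sum.lessThan_Suc)
    also have "\<dots> \<le> g x + garsia T g n (T x)" using Suc.IH[of l "T x"] Suc.prems by simp
    finally show ?thesis by simp
  qed
qed simp

lemma (in prob_space) integrable_garsia:
  assumes T: "T \<in> measurable M M" "distr M M T = M" and g: "integrable M g"
  shows "integrable M (garsia T g n)"
proof (induction n)
  case (Suc n)
  have "integrable M (\<lambda>x. garsia T g n (T x))"
    using Suc T by (metis integrable_distr)
  with g show ?case by auto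
qed simp

text \<open>Garsia's argument for \<open>g = u - \<epsilon>\<close>, whose Birkhoff sums are
  positive exactly when those of \<open>u\<close> exceed \<open>\<epsilon> * N\<close>. Where the
  maximal function m_N is positive it is at most g + m_N o T; elsewhere it is 0 and so at most m_N o
  T. After integration the two integrals of m_N cancel by invariance, leaving a nonnegative integral
  of g over the set where m_N is positive.\<close>

lemma (in prob_space) maximal_ergodic:
  assumes T[measurable]: "T \<in> measurable M M" and inv: "distr M M T = M"
    and u: "integrable M u" "\<And>x. 0 \<le> u x" and \<epsilon>: "\<epsilon> > (0::real)"
  shows "measure M {x\<in>space M. \<exists>N. (\<Sum>i<N. u ((T ^^ i) x)) > \<epsilon> * real N} \<le> (\<integral>x. u x \<partial>M) / \<epsilon>"
proof -
  define g where "g = (\<lambda>x. u x - \<epsilon>)"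
  define A where "A N = {x\<in>space M. 0 < garsia T g N x}" for N
  have g: "integrable M g" unfolding g_def using u by auto
  note ig = integrable_garsia[OF T inv g]
  note [measurable] = borel_measurable_integrable[OF ig] borel_measurable_integrable[OF u(1)]
    borel_measurable_integrable[OF g]
  have A[measurable]: "A N \<in> sets M" for N unfolding A_def by measurable
  have bound: "measure M (A N) \<le> (\<integral>x. u x \<partial>M) / \<epsilon>" for N
  proof -
    have iA: "integrable M (\<lambda>x. indicator (A N) x * g x)"
      using integrable_mult_indicator[OF A[of N] g] by simp
    have le: "garsia T g N x \<le> indicator (A N) x * g x + garsia T g N (T x)" if "x \<in> space M" for x
    proof (cases "x \<in> A N")
      case True
      then obtain n where "N = Suc n" unfolding A_def by (cases N) auto
      with True have "garsia T g N x = g x + garsia T g n (T x)" unfolding A_def by (auto simp: max_def split: if_splits)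
      also have "\<dots> \<le> g x + garsia T g N (T x)" using garsia_le_Suc[of T g n "T x"] \<open>N = Suc n\<close> by simp
      finally show ?thesis using True by simp
    next
      case False
      with that have "garsia T g N x \<le> 0" unfolding A_def by auto
      also have "0 \<le> garsia T g N (T x)" by (rule garsia_nonneg)
      finally show ?thesis using False by simp
    qed
    have igT: "integrable M (\<lambda>x. garsia T g N (T x))"
      using ig[of N] inv T by (metis integrable_distr)
    have "(\<integral>x. garsia T g N x \<partial>M) \<le> (\<integral>x. indicator (A N) x * g x + garsia T g N (T x) \<partial>M)"
      by (intro integral_mono ig Bochner_Integration.integrable_add iA igT le)
    also have "\<dots> = (\<integral>x. indicator (A N) x * g x \<partial>M) + (\<integral>x. garsia T g N (T x) \<partial>M)"
      by (intro Bochner_Integration.integral_add iA igT)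
    also have "(\<integral>x. garsia T g N (T x) \<partial>M) = (\<integral>x. garsia T g N x \<partial>M)"
      using integral_distr[OF T, of "garsia T g N"] inv by simp
    finally have "0 \<le> (\<integral>x. indicator (A N) x * g x \<partial>M)" by simp
    moreover have iI: "integrable M (\<lambda>x. \<epsilon> * indicator (A N) x)"
      by (auto simp: emeasure_eq_measure)
    \<comment> \<open>Off \<open>A N\<close> the left integrand is 0, so nonnegativity of
      \<open>u\<close> allows its integral to be taken over the whole space; this makes the bound
      uniform in \<open>N\<close>.\<close>
    moreover have "(\<integral>x. indicator (A N) x * g x \<partial>M) \<le> (\<integral>x. u x - \<epsilon> * indicator (A N) x \<partial>M)"
      using u by (intro integral_mono iA Bochner_Integration.integrable_diff iI)
        (auto simp: g_def indicator_def)
    moreover have "(\<integral>x. u x - \<epsilon> * indicator (A N) x \<partial>M) = (\<integral>x. u x \<partial>M) - \<epsilon> * measure M (A N)"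
      using u by (subst Bochner_Integration.integral_diff) (auto simp: emeasure_eq_measure)
    ultimately show ?thesis using \<epsilon> by (simp add: field_simps)
  qed
  have inc: "incseq A"
    by (intro incseq_SucI) (auto simp: A_def simp del: garsia.simps intro: less_le_trans[OF _ garsia_le_Suc])
  have "measure M (\<Union>N. A N) \<le> (\<integral>x. u x \<partial>M) / \<epsilon>"
    using bound A inc by (intro LIMSEQ_le_const2[OF finite_Lim_measure_incseq]) auto
  moreover have "{x\<in>space M. \<exists>N. (\<Sum>i<N. u ((T ^^ i) x)) > \<epsilon> * real N} \<subseteq> (\<Union>N. A N)"
  proof safe
    fix x N assume x: "x \<in> space M" and N: "(\<Sum>i<N. u ((T ^^ i) x)) > \<epsilon> * real N"
    have "0 < (\<Sum>i<N. g ((T ^^ i) x))" using N by (simp add: g_def sum_subtractf mult.commute)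
    also have "\<dots> \<le> garsia T g N x" by (rule birkhoff_sum_le_garsia) simp
    finally show "x \<in> (\<Union>N. A N)" using x by (auto simp: A_def)
  qed
  ultimately show ?thesis using finite_measure_mono A by (meson order_trans sets.countable_UN subsetI image_subset_iff)
qed

section \<open>Martingale convergence\<close>

lemma (in finite_measure) sigma_finite_subalgebraI:
  "subalgebra M F \<Longrightarrow> sigma_finite_subalgebra M F"
  by (intro finite_measure_subalgebra_is_sigma_finite finite_measure_subalgebra.intro
      finite_measure_axioms finite_measure_subalgebra_axioms.intro)

text \<open>The event is split by the first index at which the conditional expectation exceeds
  \<open>\<epsilon>\<close>. Monotonicity of the filtration puts the n-th piece into
  \<open>F n\<close>, so over it \<open>u\<close> has the same integral as its conditional
  expectation, which is at least \<open>\<epsilon>\<close> times the measure of the piece.\<close>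

lemma (in finite_measure) doob_maximal:
  assumes F: "\<And>n. subalgebra M (F n)" and mono: "\<And>m n::nat. m \<le> n \<Longrightarrow> sets (F m) \<subseteq> sets (F n)"
    and u: "integrable M u" "\<And>x. 0 \<le> u x" and \<epsilon>: "\<epsilon> > (0::real)"
  shows "measure M {x\<in>space M. \<exists>n. real_cond_exp M (F n) u x > \<epsilon>} \<le> (\<integral>x. u x \<partial>M) / \<epsilon>"
proof -
  define B where "B n = {x\<in>space M. real_cond_exp M (F n) u x > \<epsilon>}" for n
  define A where "A = disjointed B"
  have spF: "space (F n) = space M" for n using F by (auto simp: subalgebra_def)
  have BF: "B n \<in> sets (F n)" for n
    unfolding B_def spF[symmetric, of n] by measurable
  have "B i \<in> sets (F n)" if "i < n" for i n
    using BF[of i] mono[of i n] that by auto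
  then have AF: "A n \<in> sets (F n)" for n
    unfolding A_def disjointed_def using BF by (intro sets.Diff sets.finite_UN) auto
  have AM[measurable]: "A n \<in> sets M" for n using AF F by (auto simp: subalgebra_def)
  have disj: "disjoint_family A" unfolding A_def by (rule disjoint_family_disjointed)
  have int: "set_integrable M S u" if "S \<in> sets M" for S
    using integrable_mult_indicator[OF that u(1)] by (simp add: set_integrable_def)
  have le: "\<epsilon> * measure M (A n) \<le> (\<integral>x\<in>A n. u x \<partial>M)" for n
  proof -
    interpret F: sigma_finite_subalgebra M "F n" by (rule sigma_finite_subalgebraI[OF F])
    have i: "set_integrable M (A n) (real_cond_exp M (F n) u)"
      using integrable_mult_indicator[OF AM F.real_cond_exp_int(1)[OF u(1)]] by (simp add: set_integrable_def)
    have "\<epsilon> * measure M (A n) = (\<integral>x\<in>A n. \<epsilon> \<partial>M)"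
      by (simp add: set_lebesgue_integral_def)
    also have "\<dots> \<le> (\<integral>x\<in>A n. real_cond_exp M (F n) u x \<partial>M)"
      using disjointed_subset[of B n] AM[of n]
      by (intro set_integral_mono i) (auto simp: set_integrable_def A_def[symmetric] B_def emeasure_eq_measure)
    also have "\<dots> = (\<integral>x\<in>A n. u x \<partial>M)" by (rule F.real_cond_exp_intA[symmetric, OF u(1) AF])
    finally show ?thesis .
  qed
  have part: "(\<Sum>n<N. measure M (A n)) \<le> (\<integral>x. u x \<partial>M) / \<epsilon>" for N
  proof -
    have "\<epsilon> * (\<Sum>n<N. measure M (A n)) \<le> (\<Sum>n<N. \<integral>x\<in>A n. u x \<partial>M)"
      unfolding sum_distrib_left by (intro sum_mono le)
    also have "\<dots> = (\<integral>x\<in>(\<Union>n<N. A n). u x \<partial>M)"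
      using disj by (intro set_integral_finite_Union[symmetric] int) (auto simp: disjoint_family_on_def)
    also have "\<dots> \<le> (\<integral>x. u x \<partial>M)"
      unfolding set_lebesgue_integral_def
      using u int[of "\<Union>n<N. A n"] by (intro integral_mono) (auto simp: indicator_def set_integrable_def)
    finally show ?thesis using \<epsilon> by (simp add: field_simps)
  qed
  have "(\<lambda>n. measure M (A n)) sums measure M (\<Union>n. A n)"
    using AM disj by (intro finite_measure_UNION) auto
  then have "measure M (\<Union>n. A n) \<le> (\<integral>x. u x \<partial>M) / \<epsilon>"
    unfolding sums_def using part by (intro LIMSEQ_le_const2) auto
  also have "(\<Union>n. A n) = {x\<in>space M. \<exists>n. real_cond_exp M (F n) u x > \<epsilon>}"
    unfolding A_def UN_disjointed_eq by (auto simp: B_def)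
  finally show ?thesis .
qed

text \<open>The approximable functions \<open>P\<close> are closed under sums and dominated limits.
  They contain the indicators of the sets in the union of the filtration, which is stable under
  intersections, hence by the pi-lambda argument all indicators of sets of \<open>G\<close>, and
  then all integrable \<open>G\<close>-measurable functions.\<close>

lemma (in finite_measure) L1_dense_Union_subalgebras:
  fixes h :: "'a \<Rightarrow> real"
  assumes F: "\<And>n. subalgebra M (F n)" and mono: "\<And>m n::nat. m \<le> n \<Longrightarrow> sets (F m) \<subseteq> sets (F n)"
    and G: "subalgebra M G" "sets G = sigma_sets (space M) (\<Union>n. sets (F n))"
    and h: "integrable M h" "h \<in> borel_measurable G" and \<delta>: "\<delta> > 0"
  shows "\<exists>k g. g \<in> borel_measurable (F k) \<and> integrable M g \<and> (\<integral>x. \<bar>h x - g x\<bar> \<partial>M) < \<delta>"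
proof -
  define P where "P = (\<lambda>h :: 'a \<Rightarrow> real. integrable M h \<and> (\<forall>\<delta>>0. \<exists>k g. g \<in> borel_measurable (F k) \<and> integrable M g \<and> (\<integral>x. \<bar>h x - g x\<bar> \<partial>M) < \<delta>))"
  have spF: "space (F n) = space M" for n using F by (auto simp: subalgebra_def)
  have meas: "P h" if "h \<in> borel_measurable (F k)" "integrable M h" for h k
    unfolding P_def using that by (intro conjI allI impI exI[of _ k] exI[of _ h]) auto
  have addP: "P (\<lambda>x. f x + g x)" if "P f" "P g" for f g
    unfolding P_def
  proof (intro conjI allI impI)
    have i: "integrable M f" "integrable M g" using that by (auto simp: P_def)
    then show "integrable M (\<lambda>x. f x + g x)" by auto
    fix \<delta>::real assume "\<delta> > 0"
    then have "\<delta>/2 > 0" by simp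
    with that(1) obtain k f' where f': "f' \<in> borel_measurable (F k)" "integrable M f'" "(\<integral>x. \<bar>f x - f' x\<bar> \<partial>M) < \<delta>/2"
      unfolding P_def by blast
    from that(2) \<open>\<delta>/2 > 0\<close> obtain l g' where g': "g' \<in> borel_measurable (F l)" "integrable M g'" "(\<integral>x. \<bar>g x - g' x\<bar> \<partial>M) < \<delta>/2"
      unfolding P_def by blast
    note * = f' g'
    \<comment> \<open>The two approximants may live at different levels of the filtration; both are
      measurable at the larger one.\<close>
    have sub: "subalgebra (F (max k l)) (F k)" "subalgebra (F (max k l)) (F l)"
      using mono[of k "max k l"] mono[of l "max k l"] by (simp_all add: subalgebra_def spF)
    have "(\<integral>x. \<bar>(f x + g x) - (f' x + g' x)\<bar> \<partial>M) \<le> (\<integral>x. \<bar>f x - f' x\<bar> + \<bar>g x - g' x\<bar> \<partial>M)"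
      using * i by (intro integral_mono) auto
    also have "\<dots> = (\<integral>x. \<bar>f x - f' x\<bar> \<partial>M) + (\<integral>x. \<bar>g x - g' x\<bar> \<partial>M)"
      using * i by (intro Bochner_Integration.integral_add) auto
    also have "\<dots> < \<delta>" using * by simp
    finally have "(\<integral>x. \<bar>(f x + g x) - (f' x + g' x)\<bar> \<partial>M) < \<delta>" .
    moreover have "(\<lambda>x. f' x + g' x) \<in> borel_measurable (F (max k l))"
      by (intro borel_measurable_add measurable_from_subalg[OF sub(1)] measurable_from_subalg[OF sub(2)] *)
    moreover have "integrable M (\<lambda>x. f' x + g' x)" using * by auto
    ultimately show "\<exists>k h. h \<in> borel_measurable (F k) \<and> integrable M h \<and> (\<integral>x. \<bar>(f x + g x) - h x\<bar> \<partial>M) < \<delta>"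
      by blast
  qed
  have limP: "P f" if s: "\<And>i. P (s i)" and f: "integrable M f" and w: "integrable M w"
    and conv: "\<And>x. x \<in> space M \<Longrightarrow> (\<lambda>i. s i x) \<longlonglongrightarrow> f x" and dom: "\<And>i x. x \<in> space M \<Longrightarrow> \<bar>s i x\<bar> \<le> w x"
  for f s w
    unfolding P_def
  proof (intro conjI allI impI f)
    fix \<delta>::real assume "\<delta> > 0"
    then have \<delta>: "\<delta>/2 > 0" by simp
    have ints: "integrable M (s i)" for i using s by (auto simp: P_def)
    note [measurable] = borel_measurable_integrable[OF f] borel_measurable_integrable[OF ints]
    have "(\<lambda>i. \<integral>x. \<bar>f x - s i x\<bar> \<partial>M) \<longlonglongrightarrow> (\<integral>x. 0 \<partial>M)"
    proof (rule integral_dominated_convergence[where w="\<lambda>x. \<bar>f x\<bar> + w x"])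
      show "AE x in M. (\<lambda>i. \<bar>f x - s i x\<bar>) \<longlonglongrightarrow> 0"
      proof (rule AE_I2)
        fix x assume "x \<in> space M"
        from tendsto_rabs[OF tendsto_diff[OF tendsto_const conv[OF this], of "f x"]]
        show "(\<lambda>i. \<bar>f x - s i x\<bar>) \<longlonglongrightarrow> 0" by simp
      qed
      show "AE x in M. norm \<bar>f x - s i x\<bar> \<le> \<bar>f x\<bar> + w x" for i
        using dom[of _ i] by (intro AE_I2) (simp, smt (verit))
    qed (use f w in auto)
    then have "eventually (\<lambda>i. (\<integral>x. \<bar>f x - s i x\<bar> \<partial>M) < \<delta>/2) sequentially"
      using \<delta> by (intro order_tendstoD) auto
    then obtain i where i: "(\<integral>x. \<bar>f x - s i x\<bar> \<partial>M) < \<delta>/2" by (auto simp: eventually_sequentially)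
    from s[of i] \<delta> obtain k g where g: "g \<in> borel_measurable (F k)" "integrable M g" "(\<integral>x. \<bar>s i x - g x\<bar> \<partial>M) < \<delta>/2"
      unfolding P_def by blast
    have "(\<integral>x. \<bar>f x - g x\<bar> \<partial>M) \<le> (\<integral>x. \<bar>f x - s i x\<bar> + \<bar>s i x - g x\<bar> \<partial>M)"
      using g ints f by (intro integral_mono) auto
    also have "\<dots> = (\<integral>x. \<bar>f x - s i x\<bar> \<partial>M) + (\<integral>x. \<bar>s i x - g x\<bar> \<partial>M)"
      using g ints f by (intro Bochner_Integration.integral_add) auto
    also have "\<dots> < \<delta>" using i g by simp
    finally show "\<exists>k g. g \<in> borel_measurable (F k) \<and> integrable M g \<and> (\<integral>x. \<bar>f x - g x\<bar> \<partial>M) < \<delta>"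
      using g by blast
  qed
  \<comment> \<open>Congruence is closure under limits for a constant sequence.\<close>
  have cong: "P g" if "P f" "\<And>x. x \<in> space M \<Longrightarrow> f x = g x" for f g
  proof (rule limP[of "\<lambda>_. f" g "\<lambda>x. \<bar>f x\<bar>"])
    have "integrable M f" using that by (auto simp: P_def)
    moreover from this show "integrable M g" using that(2) by (simp cong: Bochner_Integration.integrable_cong)
    ultimately show "integrable M (\<lambda>x. \<bar>f x\<bar>)" by auto
  qed (use that in auto)
  have GM: "A \<in> sets M" if "A \<in> sets G" for A using that G by (auto simp: subalgebra_def)
  have iI: "integrable M (\<lambda>x. indicator A x * c :: real)" if "A \<in> sets G" for A c
    using GM[OF that] by (auto simp: emeasure_eq_measure)
  have ind: "P (\<lambda>x. indicator A x * c)" if "A \<in> sets G" for A c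
  proof -
    have 1: "Int_stable (\<Union>n. sets (F n))"
    proof (rule Int_stableI)
      fix a b assume "a \<in> (\<Union>n. sets (F n))" "b \<in> (\<Union>n. sets (F n))"
      then obtain i j where "a \<in> sets (F i)" "b \<in> sets (F j)" by auto
      then have "a \<in> sets (F (max i j))" "b \<in> sets (F (max i j))"
        using mono[of i "max i j"] mono[of j "max i j"] by auto
      then show "a \<inter> b \<in> (\<Union>n. sets (F n))" by auto
    qed
    have 2: "(\<Union>n. sets (F n)) \<subseteq> Pow (space M)"
      using sets.space_closed spF by (metis UN_least)
    from that have "A \<in> sigma_sets (space M) (\<Union>n. sets (F n))" using G by simp
    with 1 2 show ?thesis
    proof (induction arbitrary: c rule: sigma_sets_induct_disjoint)
      case (basic A)
      then obtain n where n: "A \<in> sets (F n)" by auto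
      then have "A \<in> sets G" using G(2) by (auto intro: sigma_sets.Basic)
      with n show ?case by (intro meas[of _ n] iI) auto
    next
      case empty
      show ?case by (rule meas[of _ 0]) auto
    next
      case (compl A)
      have "P (\<lambda>x. c)" by (intro meas[of _ 0]) auto
      \<comment> \<open>The factor \<open>c\<close> is kept arbitrary in the induction for this
        case: on the complement the function is the constant \<open>c\<close> plus \<open>-c\<close>
        times the indicator of \<open>A\<close>, so closure under sums is enough.\<close>
      from addP[OF this compl.IH[of "-c"]] show ?case
        by (rule cong) (auto simp: indicator_def)
    next
      case (union A)
      have AG: "A i \<in> sets G" for i using union G(2) by auto
      have "P (\<lambda>x. indicator (\<Union>i<n. A i) x * c)" for n
      proof (induction n)
        case 0
        show ?case by (rule meas[of _ 0]) auto
      next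
        case (Suc n)
        have "A n \<inter> A i = {}" if "i < n" for i
          using disjoint_family_onD[OF union(1), of n i] that by simp
        then have disj: "A n \<inter> (\<Union>i<n. A i) = {}" by blast
        have Un: "(\<Union>i<Suc n. A i) = (\<Union>i<n. A i) \<union> A n" by (auto simp: less_Suc_eq)
        show ?case
        proof (rule cong[OF addP[OF Suc union(3)[of n c]]])
          fix x
          show "indicator (\<Union>i<n. A i) x * c + indicator (A n) x * c = indicator (\<Union>i<Suc n. A i) x * c"
            using disj unfolding Un by (cases "x \<in> A n"; cases "x \<in> (\<Union>i<n. A i)") (simp_all, blast+)
        qed
      qed
      then show ?case
      proof (rule limP)
        show "integrable M (\<lambda>x. indicator (\<Union>i. A i) x * c)" using AG by (intro iI) auto
        show "(\<lambda>n. indicator (\<Union>i<n. A i) x * c) \<longlonglongrightarrow> indicator (\<Union>i. A i) x * c" for x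
          by (intro tendsto_intros LIMSEQ_indicator_UN)
        show "\<bar>indicator (\<Union>i<n. A i) x * c\<bar> \<le> \<bar>c\<bar>" for n x by (auto simp: indicator_def)
      qed auto
    qed
  qed
  have spG: "space G = space M" using G by (auto simp: subalgebra_def)
  \<comment> \<open>The induction runs over the restricted measure so that its simple functions are
    built from sets of \<open>G\<close>, the only ones covered by \<open>ind\<close>.\<close>
  have "integrable (restr_to_subalg M G) h" by (rule integrable_in_subalg[OF G(1) h(2,1)])
  then have "P h"
  proof (induction rule: integrable_induct)
    case (base A c)
    then show ?case using ind G by (simp add: sets_restr_to_subalg)
  next
    case (add f g)
    then show ?case using addP by blast
  next
    case (lim f s)
    have f: "integrable M f" by (rule integrable_from_subalg[OF G(1) lim.hyps(4)])
    show ?case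
    \<comment> \<open>The factor 2 is the domination constant that \<open>integrable_induct\<close>
      supplies for its approximating sequence.\<close>
    proof (rule limP[where s=s and w="\<lambda>x. 2 * \<bar>f x\<bar>"])
      show "integrable M (\<lambda>x. 2 * \<bar>f x\<bar>)" using f by simp
    qed (use lim f spG in \<open>auto simp: space_restr_to_subalg\<close>)
  qed
  with \<delta> show ?thesis unfolding P_def by blast
qed

text \<open>Let \<open>h\<close> be the claimed limit and \<open>g\<close> an
  \<open>F k\<close>-measurable function close to it in L1, with \<open>u = |h - g|\<close>. For n
  at least k, conditioning on \<open>F n\<close> fixes \<open>g\<close>, so the distance of the n-th
  conditional expectation from \<open>h\<close> is at most E(u | F n) + u. Doob's inequality
  controls the first summand for all n at once, Markov's inequality the second.\<close>

theorem (in finite_measure) levy_upward: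
  fixes f :: "'a \<Rightarrow> real"
  assumes F: "\<And>n. subalgebra M (F n)" and mono: "\<And>m n::nat. m \<le> n \<Longrightarrow> sets (F m) \<subseteq> sets (F n)"
    and G: "subalgebra M G" "sets G = sigma_sets (space M) (\<Union>n. sets (F n))"
    and f: "integrable M f"
  shows "AE x in M. (\<lambda>n. real_cond_exp M (F n) f x) \<longlonglongrightarrow> real_cond_exp M G f x"
proof -
  define h where "h = real_cond_exp M G f"
  interpret G: sigma_finite_subalgebra M G by (rule sigma_finite_subalgebraI[OF G(1)])
  have h: "integrable M h" "h \<in> borel_measurable G" unfolding h_def using G.real_cond_exp_int(1)[OF f] by auto
  have sGF: "subalgebra G (F n)" for n
    using F[of n] G by (auto simp: subalgebra_def)
  have nested: "AE x in M. real_cond_exp M (F n) h x = real_cond_exp M (F n) f x" for n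
    unfolding h_def
    by (rule sigma_finite_subalgebra.real_cond_exp_nested_subalg[OF sigma_finite_subalgebraI[OF F] G(1) sGF f])
  have "AE x in M. \<exists>k. \<forall>n\<ge>k. \<bar>real_cond_exp M (F n) f x - h x\<bar> \<le> \<epsilon>" if "\<epsilon> > 0" for \<epsilon>
  proof (rule AE_by_small_exceptions)
    fix \<delta> :: real assume \<delta>: "\<delta> > 0"
    \<comment> \<open>Each of the two summands gets half of \<open>\<epsilon>\<close>. Requiring the
      integral of \<open>u\<close> to be below \<open>e * \<delta> / 2\<close> gives each of the
      exceptional sets \<open>A\<close> and \<open>B\<close> measure at most
      \<open>\<delta> / 2\<close>.\<close>
    define e where "e = \<epsilon> / 2"
    have e: "e > 0" using that by (simp add: e_def)
    obtain k g where g: "g \<in> borel_measurable (F k)" "integrable M g"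
      and small: "(\<integral>x. \<bar>h x - g x\<bar> \<partial>M) < e * \<delta> / 2"
      using L1_dense_Union_subalgebras[OF F mono G h, of "e * \<delta> / 2"] e \<delta> by auto
    define u where "u = (\<lambda>x. \<bar>h x - g x\<bar>)"
    have u: "integrable M u" unfolding u_def using h g by auto
    note [measurable] = borel_measurable_integrable[OF u]
    define A where "A = {x\<in>space M. \<exists>n. real_cond_exp M (F n) u x > e}"
    define B where "B = {x\<in>space M. e \<le> u x}"
    have A: "measure M A \<le> (\<integral>x. u x \<partial>M) / e"
      unfolding A_def by (rule doob_maximal[OF F mono u]) (auto simp: u_def e)
    have B: "measure M B \<le> (\<integral>x. u x \<partial>M) / e"
      unfolding B_def by (rule integral_Markov_inequality_measure[OF u sets.top]) (auto simp: u_def e)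
    have [measurable]: "A \<in> sets M" "B \<in> sets M" unfolding A_def B_def by measurable
    have "measure M (A \<union> B) \<le> measure M A + measure M B" by (rule measure_Un_le) auto
    also have "\<dots> \<le> 2 * ((\<integral>x. u x \<partial>M) / e)" using A B by simp
    also have "\<dots> \<le> \<delta>" using small e unfolding u_def by (simp add: field_simps)
    finally have AB: "measure M (A \<union> B) \<le> \<delta>" .
    have "AE x in M. n \<ge> k \<longrightarrow> \<bar>real_cond_exp M (F n) f x - h x\<bar> \<le> real_cond_exp M (F n) u x + u x" for n
    proof (cases "n \<ge> k")
      case True
      interpret S: sigma_finite_subalgebra M "F n" by (rule sigma_finite_subalgebraI[OF F])
      have "subalgebra (F n) (F k)" using mono[OF True] F by (auto simp: subalgebra_def)
      then have gn: "g \<in> borel_measurable (F n)" using g(1) by (rule measurable_from_subalg)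
      have d: "integrable M (\<lambda>x. h x - g x)" "integrable M (\<lambda>x. g x - h x)" using h g by auto
      have "AE x in M. real_cond_exp M (F n) g x = g x" by (rule S.real_cond_exp_F_meas[OF g(2) gn])
      moreover have "AE x in M. real_cond_exp M (F n) (\<lambda>x. h x - g x) x = real_cond_exp M (F n) h x - real_cond_exp M (F n) g x"
        by (rule S.real_cond_exp_diff[OF h(1) g(2)])
      moreover have "AE x in M. real_cond_exp M (F n) (\<lambda>x. g x - h x) x = real_cond_exp M (F n) g x - real_cond_exp M (F n) h x"
        by (rule S.real_cond_exp_diff[OF g(2) h(1)])
      moreover have "AE x in M. real_cond_exp M (F n) (\<lambda>x. h x - g x) x \<le> real_cond_exp M (F n) u x"
        by (rule S.real_cond_exp_mono[OF _ d(1) u]) (simp add: u_def)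
      moreover have "AE x in M. real_cond_exp M (F n) (\<lambda>x. g x - h x) x \<le> real_cond_exp M (F n) u x"
        by (rule S.real_cond_exp_mono[OF _ d(2) u]) (simp add: u_def)
      ultimately show ?thesis using nested[of n]
        by eventually_elim (auto simp: u_def)
    qed simp
    then have "AE x in M. \<forall>n\<ge>k. \<bar>real_cond_exp M (F n) f x - h x\<bar> \<le> real_cond_exp M (F n) u x + u x"
      unfolding AE_all_countable by blast
    then have "AE x in M. x \<notin> A \<union> B \<longrightarrow> (\<exists>k. \<forall>n\<ge>k. \<bar>real_cond_exp M (F n) f x - h x\<bar> \<le> \<epsilon>)"
      using AE_space
    proof eventually_elim
      case (elim x)
      show ?case
      proof (intro impI exI[of _ k] allI)
        fix n assume "x \<notin> A \<union> B" "k \<le> n"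
        with elim(2) have "real_cond_exp M (F n) u x \<le> e" "u x \<le> e" by (auto simp: A_def B_def not_less)
        with elim(1) \<open>k \<le> n\<close> show "\<bar>real_cond_exp M (F n) f x - h x\<bar> \<le> \<epsilon>" by (fastforce simp: e_def)
      qed
    qed
    with AB show "\<exists>A\<in>sets M. measure M A \<le> \<delta> \<and>
        (AE x in M. x \<notin> A \<longrightarrow> (\<exists>k. \<forall>n\<ge>k. \<bar>real_cond_exp M (F n) f x - h x\<bar> \<le> \<epsilon>))"
      by (intro bexI[of _ "A \<union> B"]) auto
  qed
  then have "AE x in M. \<exists>k. \<forall>n\<ge>k. \<bar>real_cond_exp M (F n) f x - h x\<bar> \<le> inverse (real (Suc j))" for j
    by simp
  then have "AE x in M. \<forall>j. \<exists>k. \<forall>n\<ge>k. \<bar>real_cond_exp M (F n) f x - h x\<bar> \<le> inverse (real (Suc j))"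
    unfolding AE_all_countable by blast
  then show ?thesis
  proof eventually_elim
    case (elim x)
    show ?case unfolding h_def[symmetric]
    proof (rule LIMSEQ_I)
      fix r :: real assume "0 < r"
      then obtain j where "inverse (real (Suc j)) < r" using reals_Archimedean by blast
      with elim show "\<exists>no. \<forall>n\<ge>no. norm (real_cond_exp M (F n) f x - h x) < r"
        by (metis le_less_trans real_norm_def)
    qed
  qed
qed

section \<open>Maker's ergodic theorem\<close>

text \<open>From time \<open>k\<close> on, \<open>f n\<close> is dominated by the single function
  \<open>U k\<close>, the supremum of the tail. The maximal inequality bounds all averages of
  \<open>U k\<close> simultaneously in terms of its integral, which tends to 0 by dominated
  convergence. The first \<open>k\<close> terms contribute at most \<open>k * C\<close>, which
  disappears after division by \<open>N\<close>.\<close>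

theorem (in prob_space) maker_ergodic_zero:
  fixes f :: "nat \<Rightarrow> 'a \<Rightarrow> real"
  assumes T[measurable]: "T \<in> measurable M M" and inv: "distr M M T = M"
    and f[measurable]: "\<And>n. f n \<in> borel_measurable M"
    and nonneg: "\<And>n x. 0 \<le> f n x" and le: "\<And>n x. f n x \<le> C"
    and lim: "AE x in M. (\<lambda>n. f n x) \<longlonglongrightarrow> 0"
  shows "AE x in M. (\<lambda>N. (\<Sum>n<N. f n ((T ^^ n) x)) / real N) \<longlonglongrightarrow> 0"
proof -
  define U where "U k x = (SUP n\<in>{k..}. f n x)" for k x
  have bdd: "bdd_above ((\<lambda>n. f n x) ` S)" for x S by (rule bdd_aboveI[of _ C]) (use le in auto)
  have U_ge: "f n x \<le> U k x" if "k \<le> n" for n k x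
    unfolding U_def using that by (intro cSUP_upper bdd) auto
  have U_le: "U k x \<le> C" for k x unfolding U_def by (intro cSUP_least le) auto
  have U_nonneg: "0 \<le> U k x" for k x using U_ge[of k k x] nonneg[of k x] by linarith
  have C: "0 \<le> C" using nonneg le order_trans by blast
  have [measurable]: "U k \<in> borel_measurable M" for k
    unfolding U_def by (intro borel_measurable_cSUP bdd) auto
  have iU: "integrable M (U k)" for k
    by (rule integrable_const_bound[where B=C]) (use U_nonneg U_le in auto)
  have "(\<lambda>k. \<integral>x. U k x \<partial>M) \<longlonglongrightarrow> (\<integral>x. 0 \<partial>M)"
  proof (rule integral_dominated_convergence[where w="\<lambda>_. C"])
    show "AE x in M. (\<lambda>k. U k x) \<longlonglongrightarrow> 0" using lim
    proof eventually_elim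
      case (elim x)
      show ?case
      proof (rule LIMSEQ_I)
        fix r :: real assume "0 < r"
        then have "0 < r/2" by simp
        with elim have "eventually (\<lambda>n. f n x < r/2) sequentially" by (intro order_tendstoD)
        then obtain m where m: "\<And>n. n \<ge> m \<Longrightarrow> f n x < r/2" by (auto simp: eventually_sequentially)
        have "U k x \<le> r/2" if "k \<ge> m" for k
          unfolding U_def using that by (intro cSUP_least less_imp_le[OF m]) auto
        then show "\<exists>no. \<forall>n\<ge>no. norm (U n x - 0) < r"
          using U_nonneg \<open>0 < r\<close> by (intro exI[of _ m]) fastforce
      qed
    qed
  qed (use U_nonneg U_le in auto)
  then have EU: "(\<lambda>k. \<integral>x. U k x \<partial>M) \<longlonglongrightarrow> 0" by simp
  \<comment> \<open>The index \<open>k\<close> may depend on the point. For each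
    \<open>\<delta>\<close> one \<open>k\<close> serves outside a set of measure at most
    \<open>\<delta>\<close>: it suffices that the integral of \<open>U k\<close> is below
    \<open>\<epsilon> * \<delta>\<close>.\<close>
  have "AE x in M. \<exists>k. \<forall>N. (\<Sum>n<N. U k ((T ^^ n) x)) \<le> \<epsilon> * real N" if \<epsilon>: "\<epsilon> > 0" for \<epsilon> :: real
  proof (rule AE_by_small_exceptions)
    fix \<delta> :: real assume "\<delta> > 0"
    then have "0 < \<epsilon> * \<delta>" using \<epsilon> by simp
    then have "eventually (\<lambda>k. (\<integral>x. U k x \<partial>M) < \<epsilon> * \<delta>) sequentially"
      using EU by (intro order_tendstoD)
    then obtain k where k: "(\<integral>x. U k x \<partial>M) < \<epsilon> * \<delta>" by (auto simp: eventually_sequentially)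
    define A where "A = {x\<in>space M. \<exists>N. (\<Sum>i<N. U k ((T ^^ i) x)) > \<epsilon> * real N}"
    have [measurable]: "A \<in> sets M" unfolding A_def by measurable
    have "measure M A \<le> (\<integral>x. U k x \<partial>M) / \<epsilon>"
      unfolding A_def by (rule maximal_ergodic[OF T inv iU U_nonneg \<epsilon>])
    also have "\<dots> \<le> \<delta>" using k \<epsilon> by (simp add: field_simps)
    finally show "\<exists>A\<in>sets M. measure M A \<le> \<delta> \<and>
        (AE x in M. x \<notin> A \<longrightarrow> (\<exists>k. \<forall>N. (\<Sum>n<N. U k ((T ^^ n) x)) \<le> \<epsilon> * real N))"
      by (intro bexI[of _ A] conjI AE_I2) (auto simp: A_def not_less)
  qed
  then have "AE x in M. \<exists>k. \<forall>N. (\<Sum>n<N. U k ((T ^^ n) x)) \<le> inverse (real (Suc j)) * real N" for j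
    by simp
  then have "AE x in M. \<forall>j. \<exists>k. \<forall>N. (\<Sum>n<N. U k ((T ^^ n) x)) \<le> inverse (real (Suc j)) * real N"
    unfolding AE_all_countable by blast
  then show ?thesis
  proof eventually_elim
    case (elim x)
    show ?case
    proof (rule LIMSEQ_I)
      fix r :: real assume r: "0 < r"
      then obtain j where j: "inverse (real (Suc j)) < r/2" using reals_Archimedean[of "r/2"] by auto
      from elim obtain k where k: "\<And>N. (\<Sum>n<N. U k ((T ^^ n) x)) \<le> inverse (real (Suc j)) * real N" by blast
      have bound: "(\<Sum>n<N. f n ((T ^^ n) x)) \<le> real k * C + r / 2 * real N" for N
      proof -
        have "(\<Sum>n<N. f n ((T ^^ n) x)) \<le> (\<Sum>n<N. (if n < k then C else 0) + U k ((T ^^ n) x))"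
          using le U_ge[of k] U_nonneg by (intro sum_mono) (smt (verit) not_less)
        also have "\<dots> = C * real (card {n. n < N \<and> n < k}) + (\<Sum>n<N. U k ((T ^^ n) x))"
          by (simp add: sum.distrib sum.If_cases Int_def)
        also have "\<dots> \<le> real k * C + r / 2 * real N"
        proof (rule add_mono)
          have "card {n. n < N \<and> n < k} \<le> card {..<k}" by (intro card_mono) auto
          then show "C * real (card {n. n < N \<and> n < k}) \<le> real k * C"
            using C by (simp add: mult.commute mult_left_mono)
          have "inverse (real (Suc j)) * real N \<le> r / 2 * real N"
            using j by (intro mult_right_mono) auto
          with k[of N] show "(\<Sum>n<N. U k ((T ^^ n) x)) \<le> r / 2 * real N" by linarith
        qed
        finally show ?thesis .
      qed
      \<comment> \<open>Beyond \<open>m\<close> the contribution \<open>k * C\<close> of the initial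
        terms is below half of \<open>r * N\<close>; the other half pays for the tail.\<close>
      obtain m :: nat where m: "2 * real k * C / r < real m" using reals_Archimedean2 by blast
      show "\<exists>no. \<forall>N\<ge>no. norm ((\<Sum>n<N. f n ((T ^^ n) x)) / real N - 0) < r"
      proof (intro exI[of _ "Suc m"] allI impI)
        fix N assume N: "N \<ge> Suc m"
        have pos: "0 < real N" using N by simp
        have "2 * real k * C < r * real m" using m r by (simp add: field_simps)
        also have "\<dots> < r * real N" using N r by simp
        finally have "(\<Sum>n<N. f n ((T ^^ n) x)) < r * real N" using bound[of N] by simp
        moreover have "0 \<le> (\<Sum>n<N. f n ((T ^^ n) x))" by (intro sum_nonneg nonneg)
        ultimately show "norm ((\<Sum>n<N. f n ((T ^^ n) x)) / real N - 0) < r"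
          using pos by (simp add: field_simps)
      qed
    qed
  qed
qed

section \<open>Conditional expectations under measure-preserving maps and null sets\<close>

text \<open>Every set of the pulled-back algebra is a preimage of a set of \<open>F\<close>, and a
  measure-preserving change of variables carries the defining integral identity from that set to its
  preimage.\<close>

lemma (in prob_space) real_cond_exp_measure_preserving:
  assumes T[measurable]: "T \<in> measurable M M" and inv: "distr M M T = M"
    and F: "subalgebra M F" and f: "integrable M (f :: 'a \<Rightarrow> real)"
  shows "subalgebra M (vimage_algebra (space M) T F)"
    and "AE x in M. real_cond_exp M (vimage_algebra (space M) T F) (\<lambda>x. f (T x)) x = real_cond_exp M F f (T x)"
proof -
  let ?V = "vimage_algebra (space M) T F"
  interpret F: sigma_finite_subalgebra M F by (rule sigma_finite_subalgebraI[OF F])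
  have Tsp: "T \<in> space M \<rightarrow> space F" using F measurable_space[OF T] by (auto simp: subalgebra_def)
  have TF: "T \<in> measurable M F"
    using F measurable_space[OF T] measurable_sets[OF T] by (auto simp: subalgebra_def measurable_def)
  show V: "subalgebra M ?V"
    using measurable_sets[OF TF] by (auto simp: subalgebra_def sets_vimage_algebra2[OF Tsp])
  interpret V: sigma_finite_subalgebra M ?V by (rule sigma_finite_subalgebraI[OF V])
  have comp: "integrable M (\<lambda>x. g (T x))" "(\<integral>x. g (T x) \<partial>M) = (\<integral>x. g x \<partial>M)"
    if "integrable M g" for g :: "'a \<Rightarrow> real"
  proof -
    have [measurable]: "g \<in> borel_measurable M" using that by auto
    show "integrable M (\<lambda>x. g (T x))" using integrable_distr_eq[OF T, of g] inv that by simp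
    show "(\<integral>x. g (T x) \<partial>M) = (\<integral>x. g x \<partial>M)" using integral_distr[OF T, of g] inv by simp
  qed
  show "AE x in M. real_cond_exp M ?V (\<lambda>x. f (T x)) x = real_cond_exp M F f (T x)"
  proof (rule V.real_cond_exp_charact)
    fix A assume "A \<in> sets ?V"
    then obtain B where B: "B \<in> sets F" "A = T -` B \<inter> space M" by (auto simp: sets_vimage_algebra2[OF Tsp])
    then have BM: "B \<in> sets M" using F by (auto simp: subalgebra_def)
    have *: "(\<integral>x\<in>A. g (T x) \<partial>M) = (\<integral>x\<in>B. g x \<partial>M)" if "integrable M g" for g :: "'a \<Rightarrow> real"
    proof -
      have "(\<integral>x\<in>A. g (T x) \<partial>M) = (\<integral>x. indicator B (T x) *\<^sub>R g (T x) \<partial>M)"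
        unfolding set_lebesgue_integral_def B(2) by (intro Bochner_Integration.integral_cong) (auto simp: indicator_def)
      also have "\<dots> = (\<integral>x\<in>B. g x \<partial>M)"
        unfolding set_lebesgue_integral_def using comp(2)[OF integrable_mult_indicator[OF BM that]] by simp
      finally show ?thesis .
    qed
    show "(\<integral>x\<in>A. f (T x) \<partial>M) = (\<integral>x\<in>A. real_cond_exp M F f (T x) \<partial>M)"
      using *[OF f] *[OF F.real_cond_exp_int(1)[OF f]] F.real_cond_exp_intA[OF f B(1)] by simp
  next
    show "integrable M (\<lambda>x. f (T x))" by (rule comp(1)[OF f])
    show "integrable M (\<lambda>x. real_cond_exp M F f (T x))" by (rule comp(1)[OF F.real_cond_exp_int(1)[OF f]])
    show "(\<lambda>x. real_cond_exp M F f (T x)) \<in> borel_measurable ?V"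
      by (rule measurable_compose[OF measurable_vimage_algebra1[OF Tsp]]) simp
  qed
qed

text \<open>Adjoining the $M$-null sets lets \<open>\<alpha>\<close> and \<open>D\<close>, which agree only up to null sets, be exchanged
  inside conditional expectations.\<close>

definition null_extension :: "'a measure \<Rightarrow> 'a measure \<Rightarrow> 'a measure" where
  "null_extension M F =
     sigma (space M) {A \<in> sets M. \<exists>B\<in>sets F. AE x in M. x \<in> A \<longleftrightarrow> x \<in> B}"

lemma space_null_extension [simp]: "space (null_extension M F) = space M"
  unfolding null_extension_def by (rule space_measure_of) (auto dest: sets.sets_into_space)

text \<open>The generating family is already a sigma-algebra, because countably many null
  discrepancies have a null union.\<close>

lemma sets_null_extension:
  assumes "subalgebra M F"
  shows "sets (null_extension M F) = {A \<in> sets M. \<exists>B\<in>sets F. AE x in M. x \<in> A \<longleftrightarrow> x \<in> B}" (is "_ = ?H")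
proof -
  have spF: "space F = space M" using assms by (auto simp: subalgebra_def)
  have "sigma_algebra (space M) ?H"
    unfolding sigma_algebra_iff2
  proof (intro conjI ballI allI impI)
    show "?H \<subseteq> Pow (space M)" by (auto dest: sets.sets_into_space)
    show "{} \<in> ?H" by auto
  next
    fix A assume "A \<in> ?H"
    then obtain B where *: "A \<in> sets M" "B \<in> sets F" "AE x in M. x \<in> A \<longleftrightarrow> x \<in> B" by auto
    have "space F - B \<in> sets F" using *(2) by auto
    moreover have "AE x in M. x \<in> space M - A \<longleftrightarrow> x \<in> space F - B"
      using *(3) by eventually_elim (simp add: spF)
    ultimately show "space M - A \<in> ?H" using *(1) by blast
  next
    fix A :: "nat \<Rightarrow> _" assume "range A \<subseteq> ?H"
    then have A: "\<And>i. A i \<in> sets M" and "\<forall>i. \<exists>B\<in>sets F. AE x in M. x \<in> A i \<longleftrightarrow> x \<in> B" by auto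
    then obtain B where B: "\<And>i. B i \<in> sets F" "\<And>i. AE x in M. x \<in> A i \<longleftrightarrow> x \<in> B i" by metis
    have "AE x in M. \<forall>i. x \<in> A i \<longleftrightarrow> x \<in> B i" unfolding AE_all_countable using B(2) by blast
    then have "AE x in M. x \<in> (\<Union>i. A i) \<longleftrightarrow> x \<in> (\<Union>i. B i)" by eventually_elim auto
    moreover have "(\<Union>i. A i) \<in> sets M" "(\<Union>i. B i) \<in> sets F" using A B by auto
    ultimately show "(\<Union>i. A i) \<in> ?H" by blast
  qed
  then show ?thesis
    unfolding null_extension_def using sigma_algebra.sets_measure_of_eq by blast
qed

lemma in_null_extensionI:
  assumes "subalgebra M F" "A \<in> sets M" "B \<in> sets F" "AE x in M. x \<in> A \<longleftrightarrow> x \<in> B"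
  shows "A \<in> sets (null_extension M F)"
  using assms by (auto simp: sets_null_extension)

lemma subalgebra_null_extension:
  assumes "subalgebra M F"
  shows "subalgebra M (null_extension M F)" "subalgebra (null_extension M F) F"
  using assms by (auto simp: subalgebra_def sets_null_extension[OF assms])

lemma null_extension_subset:
  assumes F: "subalgebra M F" and G: "subalgebra M G" and sub: "sets F \<subseteq> sets (null_extension M G)"
  shows "sets (null_extension M F) \<subseteq> sets (null_extension M G)"
proof
  fix A assume "A \<in> sets (null_extension M F)"
  then obtain B where B: "A \<in> sets M" "B \<in> sets F" "AE x in M. x \<in> A \<longleftrightarrow> x \<in> B"
    by (auto simp: sets_null_extension[OF F])
  with sub obtain C where C: "C \<in> sets G" "AE x in M. x \<in> B \<longleftrightarrow> x \<in> C"
    by (auto simp: sets_null_extension[OF G])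
  have "AE x in M. x \<in> A \<longleftrightarrow> x \<in> C" using B(3) C(2) by eventually_elim auto
  with B C show "A \<in> sets (null_extension M G)" by (auto simp: sets_null_extension[OF G])
qed

text \<open>Integrals do not distinguish sets that agree almost everywhere, so the identity that
  defines the conditional expectation on \<open>F\<close> extends to all sets of the
  extension.\<close>

lemma (in prob_space) real_cond_exp_null_extension:
  assumes F: "subalgebra M F" and f: "integrable M (f :: 'a \<Rightarrow> real)"
  shows "AE x in M. real_cond_exp M (null_extension M F) f x = real_cond_exp M F f x"
proof -
  let ?H = "null_extension M F"
  interpret F: sigma_finite_subalgebra M F by (rule sigma_finite_subalgebraI[OF F])
  interpret H: sigma_finite_subalgebra M ?H
    by (rule sigma_finite_subalgebraI[OF subalgebra_null_extension(1)[OF F]])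
  show ?thesis
  proof (rule H.real_cond_exp_charact[OF _ f F.real_cond_exp_int(1)[OF f]])
    fix A assume "A \<in> sets ?H"
    then obtain B where B: "A \<in> sets M" "B \<in> sets F" "AE x in M. x \<in> A \<longleftrightarrow> x \<in> B"
      by (auto simp: sets_null_extension[OF F])
    then have BM: "B \<in> sets M" using F by (auto simp: subalgebra_def)
    have *: "(\<integral>x\<in>A. g x \<partial>M) = (\<integral>x\<in>B. g x \<partial>M)" if [measurable]: "g \<in> borel_measurable M" for g :: "'a \<Rightarrow> real"
      unfolding set_lebesgue_integral_def
    proof (rule integral_cong_AE)
      show "AE x in M. indicator A x *\<^sub>R g x = indicator B x *\<^sub>R g x"
        using B(3) by eventually_elim (auto simp: indicator_def)
    qed (use B BM in measurable)
    show "(\<integral>x\<in>A. f x \<partial>M) = (\<integral>x\<in>A. real_cond_exp M F f x \<partial>M)"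
      using f by (simp add: * F.real_cond_exp_intA[OF f B(2)])
  next
    show "real_cond_exp M F f \<in> borel_measurable ?H"
      by (rule measurable_from_subalg[OF subalgebra_null_extension(2)[OF F]]) simp
  qed
qed

text \<open>Mutual inclusion up to null sets makes the two null extensions equal, and passing to the
  extension leaves each conditional expectation unchanged.\<close>

lemma (in prob_space) real_cond_exp_cong_null:
  assumes F: "subalgebra M F" and G: "subalgebra M G" and f: "integrable M (f :: 'a \<Rightarrow> real)"
    and FG: "sets F \<subseteq> sets (null_extension M G)" and GF: "sets G \<subseteq> sets (null_extension M F)"
  shows "AE x in M. real_cond_exp M F f x = real_cond_exp M G f x"
proof -
  have "sets (null_extension M F) = sets (null_extension M G)"
    using null_extension_subset[OF F G FG] null_extension_subset[OF G F GF] by auto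
  \<comment> \<open>A measure built by \<open>sigma\<close> is zero on every set, so equal
    sigma-algebras give equal measures.\<close>
  then have "null_extension M F = null_extension M G"
    by (rule measure_eqI) (simp add: null_extension_def emeasure_sigma)
  then show ?thesis
    using real_cond_exp_null_extension[OF F f] real_cond_exp_null_extension[OF G f] by auto
qed

section \<open>Conditional probabilities of the next letter\<close>

lemma space_shift_space [simp]: "space shift_space = UNIV"
  by (simp add: shift_space_def space_PiM)

lemma measurable_coordinate [measurable]:
  "(\<lambda>\<omega>. \<omega> i) \<in> measurable shift_space (count_space UNIV)"
  unfolding shift_space_def by (rule measurable_component_singleton) simp

lemma measurable_lshift [measurable]: "lshift \<in> measurable shift_space shift_space"
proof -
  have "lshift \<in> measurable shift_space (Pi\<^sub>M UNIV (\<lambda>_. count_space UNIV))"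
    by (rule measurable_PiM_single') (auto simp: lshift_def PiE_def)
  then show ?thesis by (simp add: shift_space_def)
qed

lemma lshift_funpow: "(lshift ^^ n) \<omega> j = \<omega> (j + int n)"
  by (induction n arbitrary: j) (simp_all add: lshift_def algebra_simps)

lemma bij_lshift: "bij lshift"
  by (rule o_bij[of "\<lambda>\<omega> j. \<omega> (j - 1)"]) (auto simp: lshift_def fun_eq_iff)

text \<open>Packing the observed letters into a list makes the observation one random variable with
  values in a countable space, in which finitely many values occur for each
  \<open>n\<close>.\<close>

definition word :: "nat \<Rightarrow> (int \<Rightarrow> 'a) \<Rightarrow> 'a list" where
  "word n \<omega> = map (\<lambda>i. \<omega> (int i)) [0..<n]"

lemma length_word [simp]: "length (word n \<omega>) = n"
  by (simp add: word_def)

lemma nth_word: "i < n \<Longrightarrow> word n \<omega> ! i = \<omega> (int i)"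
  by (simp add: word_def)

lemma word_eq_iff: "word n \<omega> = s \<longleftrightarrow> length s = n \<and> (\<forall>i<n. \<omega> (int i) = s ! i)"
  by (auto simp: list_eq_iff_nth_eq nth_word)

lemma measurable_word [measurable]:
  "word n \<in> measurable shift_space (count_space (UNIV :: 'a::finite list set))"
proof -
  have "word n -` {s} \<inter> space shift_space \<in> sets shift_space" for s :: "'a list"
  proof -
    have "word n -` {s} \<inter> space shift_space = {\<omega> \<in> space shift_space. length s = n \<and> (\<forall>i<n. \<omega> (int i) = s ! i)}"
      by (auto simp: word_eq_iff nth_word)
    also have "\<dots> \<in> sets shift_space" by measurable
    finally show ?thesis .
  qed
  then show ?thesis by (simp add: measurable_count_space_eq2_countable)
qed

text \<open>Taking the word rather than the whole sequence as argument separates the observation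
  from the measure: for a fixed word this is a quotient of two probabilities, hence measurable in
  the parameter of a kernel.\<close>

definition word_cond :: "(int \<Rightarrow> 'a) measure \<Rightarrow> nat \<Rightarrow> 'a \<Rightarrow> 'a list \<Rightarrow> real" where
  "word_cond M n a s = measure M {x. word n x = s \<and> x (int n) = a} / measure M {x. word n x = s}"

lemma cond_next_eq_word_cond:
  "space M = UNIV \<Longrightarrow> cond_next M \<omega> n a = word_cond M n a (word n \<omega>)"
  by (simp add: cond_next_def word_cond_def word_eq_iff nth_word)

text \<open>The numerator event lies in the conditioning event. Hence the ratio is at most 1, and
  the product formula holds even when the conditioning event is null and the ratio takes the default
  value 0.\<close>

lemma word_cond_bounds:
  fixes M :: "(int \<Rightarrow> 'a::finite) measure"
  assumes "prob_space M" and sets: "sets M = sets shift_space"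
  shows "0 \<le> word_cond M n a s" "word_cond M n a s \<le> 1"
    and "ennreal (word_cond M n a s) * emeasure M {x. word n x = s} = emeasure M {x. word n x = s \<and> x (int n) = a}"
proof -
  interpret prob_space M by fact
  note [measurable_cong] = sets
  have sp: "space M = UNIV" using sets_eq_imp_space_eq[OF sets] by simp
  have "{x\<in>space M. word n x = s} \<in> sets M" by measurable
  then have S: "{x. word n x = s} \<in> sets M" by (simp add: sp)
  have le: "measure M {x. word n x = s \<and> x (int n) = a} \<le> measure M {x. word n x = s}"
    by (rule finite_measure_mono[OF _ S]) auto
  then show "0 \<le> word_cond M n a s" "word_cond M n a s \<le> 1"
    by (auto simp: word_cond_def divide_le_eq_1 less_le)
  have "word_cond M n a s * measure M {x. word n x = s} = measure M {x. word n x = s \<and> x (int n) = a}"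
    using le by (auto simp: word_cond_def measure_le_0_iff)
  then show "ennreal (word_cond M n a s) * emeasure M {x. word n x = s} = emeasure M {x. word n x = s \<and> x (int n) = a}"
    using \<open>0 \<le> word_cond M n a s\<close> by (simp add: emeasure_eq_measure flip: ennreal_mult)
qed

text \<open>Restricting \<open>M\<close> to \<open>S\<close> and pushing it forward by
  \<open>\<alpha>\<close> gives the measure with density \<open>emeasure (K \<theta>) S\<close>;
  \<open>dis\<close> is this equality evaluated on sets, and integrating \<open>g\<close> against
  both sides gives the claim.\<close>

lemma nn_integral_disintegrate:
  assumes \<alpha>[measurable]: "\<alpha> \<in> measurable M B" and S[measurable]: "S \<in> sets M"
    and m[measurable]: "(\<lambda>\<theta>. emeasure (K \<theta>) S) \<in> borel_measurable B"
    and dis: "\<And>C. C \<in> sets B \<Longrightarrow> emeasure M (S \<inter> (\<alpha> -` C \<inter> space M))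
        = (\<integral>\<^sup>+\<theta>\<in>C. emeasure (K \<theta>) S \<partial>distr M B \<alpha>)"
    and g[measurable]: "g \<in> borel_measurable B"
  shows "(\<integral>\<^sup>+x. indicator S x * g (\<alpha> x) \<partial>M) = (\<integral>\<^sup>+\<theta>. emeasure (K \<theta>) S * g \<theta> \<partial>distr M B \<alpha>)"
proof -
  have "distr (density M (indicator S)) B \<alpha> = density (distr M B \<alpha>) (\<lambda>\<theta>. emeasure (K \<theta>) S)"
  proof (rule measure_eqI)
    fix C assume "C \<in> sets (distr (density M (indicator S)) B \<alpha>)"
    then have C[measurable]: "C \<in> sets B" by simp
    have "emeasure (distr (density M (indicator S)) B \<alpha>) C = (\<integral>\<^sup>+x. indicator S x * indicator (\<alpha> -` C \<inter> space M) x \<partial>M)"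
      by (simp add: emeasure_distr emeasure_density)
    also have "\<dots> = (\<integral>\<^sup>+x. indicator (S \<inter> (\<alpha> -` C \<inter> space M)) x \<partial>M)"
      by (intro nn_integral_cong) (auto simp: indicator_def)
    also have "\<dots> = emeasure M (S \<inter> (\<alpha> -` C \<inter> space M))" by (intro nn_integral_indicator) measurable
    finally show "emeasure (distr (density M (indicator S)) B \<alpha>) C = emeasure (density (distr M B \<alpha>) (\<lambda>\<theta>. emeasure (K \<theta>) S)) C"
      by (simp add: emeasure_density dis)
  qed simp
  then have "(\<integral>\<^sup>+\<theta>. g \<theta> \<partial>distr (density M (indicator S)) B \<alpha>) = (\<integral>\<^sup>+\<theta>. g \<theta> \<partial>density (distr M B \<alpha>) (\<lambda>\<theta>. emeasure (K \<theta>) S))"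
    by simp
  then show ?thesis by (simp add: nn_integral_distr nn_integral_density)
qed

text \<open>As \<open>K \<theta>\<close> is the conditional law of \<open>M\<close> given
  \<open>\<alpha> = \<theta>\<close>, conditioning it further on the word amounts to conditioning
  \<open>M\<close> on the pair of word and \<alpha>. The integral identity is checked by cutting a
  set of \<open>V n\<close> along the finitely many words, disintegrating each piece, applying the
  product formula under \<open>K \<theta>\<close>, and integrating back.\<close>

lemma cond_next_kernel_eq_real_cond_exp:
  fixes M :: "(int \<Rightarrow> 'a::finite) measure"
  assumes M: "prob_space M" and sets: "sets M = sets shift_space"
    and \<alpha>[measurable]: "\<alpha> \<in> measurable M B"
    and K: "\<And>\<theta>. prob_space (K \<theta>)" "\<And>\<theta>. sets (K \<theta>) = sets shift_space"
    and m: "\<And>S. S \<in> sets shift_space \<Longrightarrow> (\<lambda>\<theta>. emeasure (K \<theta>) S) \<in> borel_measurable B"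
    and dis: "\<And>S C. S \<in> sets shift_space \<Longrightarrow> C \<in> sets B \<Longrightarrow> emeasure M (S \<inter> (\<alpha> -` C \<inter> space M))
        = (\<integral>\<^sup>+\<theta>\<in>C. emeasure (K \<theta>) S \<partial>distr M B \<alpha>)"
  defines "V \<equiv> \<lambda>n. vimage_algebra (space M) (\<lambda>x. (word n x, \<alpha> x)) (count_space UNIV \<Otimes>\<^sub>M B)"
  shows "subalgebra M (V n)"
    and "AE x in M. real_cond_exp M (V n) (indicator {x. x (int n) = a}) x = cond_next (K (\<alpha> x)) x n a"
proof -
  interpret prob_space M by fact
  note [measurable_cong] = sets
  have sp: "space M = UNIV" "\<And>\<theta>. space (K \<theta>) = UNIV"
    using sets_eq_imp_space_eq[OF sets] sets_eq_imp_space_eq[OF K(2)] by auto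
  define X where "X = (\<lambda>x. (word n x, \<alpha> x))"
  have X[measurable]: "X \<in> measurable M (count_space UNIV \<Otimes>\<^sub>M B)" unfolding X_def by measurable
  have Xsp: "X \<in> space M \<rightarrow> space (count_space UNIV \<Otimes>\<^sub>M B)" using measurable_space[OF X] by auto
  have V_eq: "V n = vimage_algebra (space M) X (count_space UNIV \<Otimes>\<^sub>M B)" unfolding V_def X_def ..
  show V: "subalgebra M (V n)"
    using measurable_sets[OF X] by (auto simp: subalgebra_def V_eq sets_vimage_algebra2[OF Xsp])
  interpret V: sigma_finite_subalgebra M "V n" by (rule sigma_finite_subalgebraI[OF V])
  define r where "r s \<theta> = word_cond (K \<theta>) n a s" for s \<theta>
  define q where "q x = r (word n x) (\<alpha> x)" for x
  define f where "f = (indicator {x. x (int n) = a} :: _ \<Rightarrow> real)"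
  define S where "S s = {x :: int \<Rightarrow> 'a. word n x = s}" for s
  define S' where "S' s = {x :: int \<Rightarrow> 'a. word n x = s \<and> x (int n) = a}" for s
  have "{x\<in>space shift_space. word n x = s} \<in> sets shift_space"
    "{x\<in>space shift_space. word n x = s \<and> x (int n) = a} \<in> sets shift_space" for s by measurable
  then have S[measurable]: "S s \<in> sets shift_space" "S' s \<in> sets shift_space" for s by (simp_all add: S_def S'_def)
  have rm[measurable]: "r s \<in> borel_measurable B" for s
    unfolding r_def word_cond_def measure_def S_def[symmetric] S'_def[symmetric]
    using m[OF S(1)] m[OF S(2)] by measurable
  \<comment> \<open>Joint measurability comes from countability of the set of lists: for each fixed
    word only measurability in the parameter is left.\<close>
  have rX: "(\<lambda>p. r (fst p) (snd p)) \<in> borel_measurable (count_space UNIV \<Otimes>\<^sub>M B)"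
    by (rule measurable_compose_countable'[where I=UNIV and g=fst and f="\<lambda>s p. r s (snd p)"]) auto
  have qV: "q \<in> borel_measurable (V n)"
    unfolding q_def V_eq using measurable_compose[OF measurable_vimage_algebra1[OF Xsp] rX] by (simp add: X_def)
  have qM[measurable]: "q \<in> borel_measurable M" by (rule measurable_from_subalg[OF V qV])
  have fM[measurable]: "f \<in> borel_measurable M"
  proof -
    have "(indicator {x\<in>space M. x (int n) = a} :: _ \<Rightarrow> real) \<in> borel_measurable M" by measurable
    then show ?thesis by (simp add: f_def sp)
  qed
  have q01: "0 \<le> q x" "q x \<le> 1" for x
    unfolding q_def r_def by (rule word_cond_bounds[OF K])+
  have f01: "0 \<le> f x" "f x \<le> 1" for x by (auto simp: f_def)
  define W where "W = {s :: 'a list. length s = n}"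
  have W: "finite W" unfolding W_def using finite_lists_length_eq[of "UNIV :: 'a set" n] by simp
  have nn: "(\<integral>\<^sup>+x\<in>A. f x \<partial>M) = (\<integral>\<^sup>+x\<in>A. q x \<partial>M)" if A: "A \<in> sets (V n)" for A
  proof -
    from A obtain C where C: "C \<in> sets (count_space UNIV \<Otimes>\<^sub>M B)" "A = X -` C \<inter> space M"
      by (auto simp: V_eq sets_vimage_algebra2[OF Xsp])
    \<comment> \<open>On the event that the word is \<open>s\<close>, membership in \<open>A\<close>
      means that \<alpha> lies in the section of \<open>C\<close> at \<open>s\<close>.\<close>
    define D where "D s = Pair s -` C" for s
    have D[measurable]: "D s \<in> sets B" for s unfolding D_def by (rule sets_Pair1[OF C(1)])
    have single: "(\<Sum>s\<in>W. if word n x = s then h s else 0) = h (word n x)" for h :: "'a list \<Rightarrow> ennreal" and x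
      using W by (simp add: W_def)
    have "(\<integral>\<^sup>+x\<in>A. f x \<partial>M) = (\<integral>\<^sup>+x. (\<Sum>s\<in>W. indicator (S' s) x * indicator (D s) (\<alpha> x)) \<partial>M)"
    proof (rule nn_integral_cong)
      fix x
      have "(\<Sum>s\<in>W. indicator (S' s) x * indicator (D s) (\<alpha> x)) =
          (\<Sum>s\<in>W. if word n x = s then ennreal (f x) * indicator (D s) (\<alpha> x) else 0 :: ennreal)"
        by (intro sum.cong) (auto simp: S'_def f_def indicator_def)
      then show "ennreal (f x) * indicator A x = (\<Sum>s\<in>W. indicator (S' s) x * indicator (D s) (\<alpha> x))"
        by (simp add: single) (simp add: C(2) D_def X_def sp indicator_def)
    qed
    also have "\<dots> = (\<Sum>s\<in>W. \<integral>\<^sup>+x. indicator (S' s) x * indicator (D s) (\<alpha> x) \<partial>M)"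
      by (rule nn_integral_sum) measurable
    also have "\<dots> = (\<Sum>s\<in>W. \<integral>\<^sup>+\<theta>. emeasure (K \<theta>) (S' s) * indicator (D s) \<theta> \<partial>distr M B \<alpha>)"
      by (intro sum.cong nn_integral_disintegrate \<alpha> m dis S refl) (simp_all add: sets)
    \<comment> \<open>The product formula replaces the event that \<open>s\<close> is followed by
      \<open>a\<close> by the event \<open>S s\<close> weighted with the prediction
      \<open>r s \<theta>\<close>.\<close>
    also have "\<dots> = (\<Sum>s\<in>W. \<integral>\<^sup>+\<theta>. emeasure (K \<theta>) (S s) * (ennreal (r s \<theta>) * indicator (D s) \<theta>) \<partial>distr M B \<alpha>)"
      using word_cond_bounds(3)[OF K]
      by (intro sum.cong nn_integral_cong refl) (auto simp: S_def S'_def r_def indicator_def mult.commute[of "emeasure _ _"])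
    also have "\<dots> = (\<Sum>s\<in>W. \<integral>\<^sup>+x. indicator (S s) x * (ennreal (r s (\<alpha> x)) * indicator (D s) (\<alpha> x)) \<partial>M)"
      by (intro sum.cong nn_integral_disintegrate[symmetric] \<alpha> m dis S refl) (simp_all add: sets)
    also have "\<dots> = (\<integral>\<^sup>+x. (\<Sum>s\<in>W. indicator (S s) x * (ennreal (r s (\<alpha> x)) * indicator (D s) (\<alpha> x))) \<partial>M)"
      by (rule nn_integral_sum[symmetric]) measurable
    also have "\<dots> = (\<integral>\<^sup>+x\<in>A. q x \<partial>M)"
    proof (rule nn_integral_cong)
      fix x
      have "(\<Sum>s\<in>W. indicator (S s) x * (ennreal (r s (\<alpha> x)) * indicator (D s) (\<alpha> x))) =
          (\<Sum>s\<in>W. if word n x = s then ennreal (r s (\<alpha> x)) * indicator (D s) (\<alpha> x) else 0 :: ennreal)"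
        by (intro sum.cong) (auto simp: S_def)
      then show "(\<Sum>s\<in>W. indicator (S s) x * (ennreal (r s (\<alpha> x)) * indicator (D s) (\<alpha> x))) = ennreal (q x) * indicator A x"
        by (simp add: single) (simp add: C(2) D_def X_def sp indicator_def q_def)
    qed
    finally show ?thesis .
  qed
  have "AE x in M. real_cond_exp M (V n) f x = q x"
  proof (rule V.real_cond_exp_charact)
    fix A assume A: "A \<in> sets (V n)"
    then have AM[measurable]: "A \<in> sets M" using V by (auto simp: subalgebra_def)
    have *: "(\<integral>x\<in>A. g x \<partial>M) = enn2real (\<integral>\<^sup>+x\<in>A. g x \<partial>M)"
      if [measurable]: "g \<in> borel_measurable M" and g: "\<And>x. 0 \<le> g x" for g :: "_ \<Rightarrow> real"
    proof -
      have "(\<integral>x\<in>A. g x \<partial>M) = enn2real (\<integral>\<^sup>+x. ennreal (indicator A x *\<^sub>R g x) \<partial>M)"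
        unfolding set_lebesgue_integral_def using g by (intro integral_eq_nn_integral) auto
      also have "(\<integral>\<^sup>+x. ennreal (indicator A x *\<^sub>R g x) \<partial>M) = (\<integral>\<^sup>+x\<in>A. g x \<partial>M)"
        by (intro nn_integral_cong) (auto simp: indicator_def)
      finally show ?thesis .
    qed
    show "(\<integral>x\<in>A. f x \<partial>M) = (\<integral>x\<in>A. q x \<partial>M)" using nn[OF A] f01 q01 by (simp add: *)
  next
    show "integrable M f" "integrable M q"
      using f01 q01 by (auto intro!: integrable_const_bound[where B=1])
  qed (rule qV)
  then show "AE x in M. real_cond_exp M (V n) (indicator {x. x (int n) = a}) x = cond_next (K (\<alpha> x)) x n a"
    by (simp add: f_def q_def r_def cond_next_eq_word_cond sp)
qed

section \<open>Predictions as conditional expectations given the past\<close>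

lemma past_sets_eq: "past_sets = sigma_sets UNIV {{\<omega>. \<omega> j = a} | j a. j < 0}"
  by (simp add: past_sets_def)

text \<open>The join of \<open>D\<close> with the $\sigma$-algebra $\mathcal{F}_{-n}^0$.\<close>

definition past_algebra :: "(int \<Rightarrow> 'a) set set \<Rightarrow> nat \<Rightarrow> (int \<Rightarrow> 'a) measure" where
  "past_algebra D n = sigma UNIV ({{\<omega>. \<omega> j = b} | j b. - int n \<le> j \<and> j < 0} \<union> D)"

lemma space_past_algebra [simp]: "space (past_algebra D n) = UNIV"
  by (simp add: past_algebra_def space_measure_of_conv)

lemma sets_past_algebra:
  "sets (past_algebra D n) = sigma_sets UNIV ({{\<omega>. \<omega> j = b} | j b. - int n \<le> j \<and> j < 0} \<union> D)"
  by (simp add: past_algebra_def sets_measure_of_conv)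

lemma coordinate_in_sets: "{\<omega>. \<omega> j = a} \<in> sets shift_space"
proof -
  have "{\<omega> \<in> space shift_space. \<omega> j = a} \<in> sets shift_space" by measurable
  then show ?thesis by simp
qed

lemma prediction_tracks_infinite_past:
  fixes M :: "(int \<Rightarrow> 'a::finite) measure"
  assumes M: "prob_space M" and sets: "sets M = sets shift_space" and inv: "distr M M lshift = M"
    and D_sub: "D \<subseteq> sets shift_space" and D_past: "D \<subseteq> past_sets"
    and D_vimage: "\<And>E. E \<in> D \<Longrightarrow> lshift -` E \<in> D" and D_image: "\<And>E. E \<in> D \<Longrightarrow> lshift ` E \<in> D"
    and \<alpha>: "\<alpha> \<in> measurable M B"
    and gen1: "\<And>E. E \<in> D \<Longrightarrow> \<exists>C\<in>sets B. AE x in M. x \<in> E \<longleftrightarrow> \<alpha> x \<in> C"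
    and gen2: "\<And>C. C \<in> sets B \<Longrightarrow> \<exists>E\<in>D. AE x in M. x \<in> E \<longleftrightarrow> \<alpha> x \<in> C"
    and K: "\<And>\<theta>. prob_space (K \<theta>)" "\<And>\<theta>. sets (K \<theta>) = sets shift_space"
    and m: "\<And>S. S \<in> sets shift_space \<Longrightarrow> (\<lambda>\<theta>. emeasure (K \<theta>) S) \<in> borel_measurable B"
    and dis: "\<And>S C. S \<in> sets shift_space \<Longrightarrow> C \<in> sets B \<Longrightarrow> emeasure M (S \<inter> (\<alpha> -` C \<inter> space M))
        = (\<integral>\<^sup>+\<theta>\<in>C. emeasure (K \<theta>) S \<partial>distr M B \<alpha>)"
  shows "AE x in M. (\<lambda>N. (\<Sum>n<N. \<bar>cond_next (K (\<alpha> x)) x n a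
      - real_cond_exp M (sigma UNIV past_sets) (indicator {x. x 0 = a}) ((lshift ^^ n) x)\<bar>) / real N) \<longlonglongrightarrow> 0"
proof -
  interpret prob_space M by fact
  note [measurable_cong] = sets
  have sp: "space M = UNIV" using sets_eq_imp_space_eq[OF sets] by simp
  have T[measurable]: "lshift \<in> measurable M M" using measurable_lshift by (simp cong: measurable_cong_sets add: sets)
  have Tn[measurable]: "(lshift ^^ n) \<in> measurable M M" for n by measurable
  have invn: "distr M M (lshift ^^ n) = M" for n
  proof (induction n)
    case (Suc n)
    have "distr M M (lshift ^^ Suc n) = distr (distr M M (lshift ^^ n)) M lshift"
      by (subst distr_distr) (auto simp: comp_def)
    with Suc inv show ?case by (simp add: comp_def)
  qed (simp add: distr_id id_def)
  define f where "f = (indicator {x. x 0 = a} :: (int \<Rightarrow> 'a) \<Rightarrow> real)"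
  have f: "integrable M f"
    unfolding f_def using coordinate_in_sets[of 0 a] by (auto simp: sets emeasure_eq_measure)
  define G where "G = past_algebra D"
  define P where "P = (sigma UNIV past_sets :: (int \<Rightarrow> 'a) measure)"
  have setsP: "sets P = past_sets" and spP: "space P = UNIV"
    by (simp_all add: P_def sets_measure_of_conv space_measure_of_conv past_sets_eq sigma_sets_sigma_sets_eq)
  have PM: "subalgebra M P"
  proof -
    have "past_sets \<subseteq> sets M"
      unfolding past_sets_eq using coordinate_in_sets
      by (intro sets.sigma_sets_subset[of _ M, unfolded sp]) (auto simp: sets)
    then show ?thesis by (auto simp: subalgebra_def sp spP setsP)
  qed
  \<comment> \<open>Here \<open>D_past\<close> enters: adjoining \<open>D\<close> never leads
    outside the infinite past, so the algebras \<open>G n\<close> generate exactly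
    \<open>P\<close>.\<close>
  have GP: "sets (G n) \<subseteq> sets P" for n
  proof -
    have "{\<omega>. \<omega> j = b} \<in> past_sets" if "j < 0" for j and b :: 'a
      unfolding past_sets_eq using that by (intro sigma_sets.Basic) auto
    then have "{{\<omega>. \<omega> j = b} | j b. - int n \<le> j \<and> j < 0} \<union> D \<subseteq> sets P"
      using D_past by (auto simp: setsP)
    from sets.sigma_sets_subset[OF this] show ?thesis by (simp add: G_def sets_past_algebra spP)
  qed
  have GM: "subalgebra M (G n)" for n
    using GP[of n] PM by (auto simp: subalgebra_def sp G_def)
  have Gmono: "sets (G k) \<subseteq> sets (G n)" if "k \<le> n" for k n
    unfolding G_def sets_past_algebra using that by (intro sigma_sets_mono') auto
  have P_gen: "sets P = sigma_sets (space M) (\<Union>n. sets (G n))"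
  proof
    show "sets P \<subseteq> sigma_sets (space M) (\<Union>n. sets (G n))"
      unfolding setsP past_sets_eq sp
    proof (rule sigma_sets_mono, safe)
      fix j :: int and b :: 'a assume "j < 0"
      then have "{\<omega>. \<omega> j = b} \<in> sets (G (nat (- j)))"
        unfolding G_def sets_past_algebra by (intro sigma_sets.Basic) auto
      then show "{\<omega>. \<omega> j = b} \<in> sigma_sets UNIV (\<Union>n. sets (G n))" by (intro sigma_sets.Basic) auto
    qed
    show "sigma_sets (space M) (\<Union>n. sets (G n)) \<subseteq> sets P"
      using sets.sigma_sets_subset[of "\<Union>n. sets (G n)" P] GP by (auto simp: sp spP)
  qed
  define e where "e n = real_cond_exp M (G n) f" for n
  define h where "h = real_cond_exp M P f"
  have [measurable]: "e n \<in> borel_measurable M" "h \<in> borel_measurable M" for n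
    unfolding e_def h_def by auto
  have levy: "AE x in M. (\<lambda>n. e n x) \<longlonglongrightarrow> h x"
    unfolding e_def h_def by (rule levy_upward[OF GM Gmono PM P_gen f])
  have bounds: "AE x in M. 0 \<le> real_cond_exp M F f x \<and> real_cond_exp M F f x \<le> 1" if "subalgebra M F" for F
  proof -
    interpret F: sigma_finite_subalgebra M F by (rule sigma_finite_subalgebraI[OF that])
    have "AE x in M. 0 \<le> real_cond_exp M F f x" by (rule F.real_cond_exp_ge_c[OF f]) (auto simp: f_def)
    moreover have "AE x in M. real_cond_exp M F f x \<le> 1" by (rule F.real_cond_exp_le_c[OF f]) (auto simp: f_def)
    ultimately show ?thesis by eventually_elim auto
  qed
  have AE_T: "AE x in M. Q ((lshift ^^ n) x)" if "AE x in M. Q x" for Q n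
  proof -
    have "AE x in distr M M (lshift ^^ n). Q x" unfolding invn by (rule that)
    then show ?thesis by (rule AE_distrD[OF Tn])
  qed
  have le1: "AE x in M. \<bar>e n ((lshift ^^ n) x) - h ((lshift ^^ n) x)\<bar> \<le> 1" for n
  proof (rule AE_T)
    show "AE x in M. \<bar>e n x - h x\<bar> \<le> 1"
      using bounds[OF GM[of n]] bounds[OF PM] unfolding e_def h_def by eventually_elim auto
  qed
  \<comment> \<open>Pulling \<open>G n\<close> back by n shifts turns the coordinates -n, ..., -1
    into 0, ..., n-1 and keeps the sets of \<open>D\<close> within \<open>D\<close>. The resulting
    \<open>G'\<close> agrees up to null sets with the algebra \<open>V\<close> of the word and
    \<alpha>, for which the conditional expectation is the kernel's prediction.\<close>
  have ident: "AE x in M. e n ((lshift ^^ n) x) = cond_next (K (\<alpha> x)) x n a" for n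
  proof -
    define V where "V = vimage_algebra (space M) (\<lambda>x. (word n x, \<alpha> x)) (count_space UNIV \<Otimes>\<^sub>M B)"
    define G' where "G' = vimage_algebra (space M) (lshift ^^ n) (G n)"
    have fT: "f ((lshift ^^ n) x) = indicator {x. x (int n) = a} x" for x
      by (simp add: f_def lshift_funpow indicator_def)
    have iT: "integrable M (indicator {x. x (int n) = a} :: (int \<Rightarrow> 'a) \<Rightarrow> real)"
      using coordinate_in_sets[of "int n" a] by (auto simp: sets emeasure_eq_measure)
    have V: "subalgebra M V"
      "AE x in M. real_cond_exp M V (indicator {x. x (int n) = a}) x = cond_next (K (\<alpha> x)) x n a"
      unfolding V_def by (rule cond_next_kernel_eq_real_cond_exp[OF M sets \<alpha> K m dis]; assumption)+
    note G' = real_cond_exp_measure_preserving[OF Tn invn GM f, of n n, folded G'_def]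
    \<comment> \<open>Preimages of sets of \<open>D\<close> stay in \<open>D\<close>, hence are
      determined by \<alpha> up to null sets; this gives the inclusion of \<open>G'\<close> in the
      extension of \<open>V\<close>.\<close>
    have vim: "(lshift ^^ k) -` E \<in> D" if "E \<in> D" for E k
      using that
    proof (induction k arbitrary: E)
      case (Suc k)
      have "(lshift ^^ Suc k) -` E = (lshift ^^ k) -` (lshift -` E)" by auto
      with Suc.IH[OF D_vimage[OF Suc.prems]] show ?case by (simp only:)
    qed simp
    \<comment> \<open>Conversely every set of \<open>D\<close> is itself such a preimage, so
      \<open>D\<close> is contained in \<open>G'\<close>; this gives the inclusion of
      \<open>V\<close> in the extension of \<open>G'\<close>.\<close>
    have img: "\<exists>E'\<in>D. E = (lshift ^^ k) -` E'" if "E \<in> D" for E k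
      using that
    proof (induction k arbitrary: E)
      case (Suc k)
      have "lshift -` (lshift ` E) = E" by (rule inj_vimage_image_eq[OF bij_is_inj[OF bij_lshift]])
      moreover obtain E' where "E' \<in> D" "lshift ` E = (lshift ^^ k) -` E'"
        using Suc.IH[OF D_image[OF Suc.prems]] by blast
      moreover have "(lshift ^^ Suc k) -` E' = lshift -` ((lshift ^^ k) -` E')"
        unfolding funpow_Suc_right by auto
      ultimately show ?case by metis
    qed auto
    have G'_eq: "G' = sigma UNIV {(lshift ^^ n) -` A | A. A \<in> {{\<omega>. \<omega> j = b} | j b. - int n \<le> j \<and> j < 0} \<union> D}"
      unfolding G'_def G_def past_algebra_def sp by (subst vimage_algebra_sigma) auto
    have setsG': "sets G' = sigma_sets UNIV {(lshift ^^ n) -` A | A. A \<in> {{\<omega>. \<omega> j = b} | j b. - int n \<le> j \<and> j < 0} \<union> D}"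
      unfolding G'_eq by (simp add: sets_measure_of_conv)
    have coordG': "{\<omega>. \<omega> (int i) = b} \<in> sets G'" if "i < n" for i b
    proof -
      have "{\<omega>. \<omega> (int i) = b} = (lshift ^^ n) -` {\<omega>. \<omega> (int i - int n) = b}"
        by (auto simp: lshift_funpow)
      moreover have "\<dots> \<in> sets G'"
      proof -
        have "{\<omega>. \<omega> (int i - int n) = b} \<in> {{\<omega>. \<omega> j = b} | j b. - int n \<le> j \<and> j < 0}"
          by (intro CollectI exI[of _ "int i - int n"] exI[of _ b]) (use that in auto)
        then show ?thesis unfolding setsG' by (intro sigma_sets.Basic) blast
      qed
      ultimately show ?thesis by simp
    qed
    have spG': "space G' = UNIV" by (simp add: G'_def sp)
    have wordG': "word n \<in> measurable G' (count_space UNIV)"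
    proof -
      have "word n -` {s} \<inter> space G' \<in> sets G'" for s :: "'a list"
      proof -
        have "word n -` {s} \<inter> space G' = (if length s = n then {\<omega>\<in>space G'. \<forall>i\<in>{..<n}. \<omega> (int i) = s ! i} else {})"
          by (auto simp: word_eq_iff nth_word spG')
        moreover have "{\<omega>\<in>space G'. \<forall>i\<in>{..<n}. \<omega> (int i) = s ! i} \<in> sets G'"
          by (intro sets.sets_Collect_finite_All) (use coordG' in \<open>auto simp: spG'\<close>)
        ultimately show ?thesis by auto
      qed
      then show ?thesis by (simp add: measurable_count_space_eq2_countable)
    qed
    have D_G': "E \<in> sets G'" if "E \<in> D" for E
      using img[OF that, of n] unfolding setsG' by (auto intro: sigma_sets.Basic)
    let ?H = "null_extension M G'"
    \<comment> \<open>A preimage under \<alpha> matches a set of \<open>D\<close> only almost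
      surely, so \<alpha> is shown measurable for the null extension rather than for
      \<open>G'\<close> itself.\<close>
    have "\<alpha> \<in> measurable ?H B"
    proof (rule measurableI)
      fix C assume C: "C \<in> sets B"
      then obtain E where E: "E \<in> D" "AE x in M. x \<in> E \<longleftrightarrow> \<alpha> x \<in> C" using gen2 by blast
      have "AE x in M. x \<in> \<alpha> -` C \<inter> space M \<longleftrightarrow> x \<in> E" using E(2) by eventually_elim (auto simp: sp)
      with D_G'[OF E(1)] measurable_sets[OF \<alpha> C] show "\<alpha> -` C \<inter> space ?H \<in> sets ?H"
        by (auto simp: sets_null_extension[OF G'(1)])
    qed (use measurable_space[OF \<alpha>] in simp)
    moreover have "word n \<in> measurable ?H (count_space UNIV)"
      by (rule measurable_from_subalg[OF subalgebra_null_extension(2)[OF G'(1)] wordG'])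
    ultimately have X: "(\<lambda>x. (word n x, \<alpha> x)) \<in> measurable ?H (count_space UNIV \<Otimes>\<^sub>M B)"
      by (intro measurable_Pair)
    have VG': "sets V \<subseteq> sets ?H"
      unfolding V_def using measurable_sets[OF X] measurable_space[OF X]
      by (subst sets_vimage_algebra2) auto
    have G'V: "sets G' \<subseteq> sets (null_extension M V)"
    proof -
      have "(\<lambda>x. (word n x, \<alpha> x)) \<in> measurable V (count_space UNIV \<Otimes>\<^sub>M B)"
        unfolding V_def using measurable_space[OF \<alpha>] by (intro measurable_vimage_algebra1) (auto simp: space_pair_measure)
      from measurable_compose[OF this measurable_fst] measurable_compose[OF this measurable_snd]
      have wV: "word n \<in> measurable V (count_space UNIV)" and aV: "\<alpha> \<in> measurable V B" by simp_all
      have spV: "space V = UNIV" by (simp add: V_def sp)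
      have "(lshift ^^ n) -` A \<in> sets (null_extension M V)"
        if "A \<in> {{\<omega>. \<omega> j = b} | j b. - int n \<le> j \<and> j < 0} \<union> D" for A
        using that
      proof
        assume "A \<in> {{\<omega>. \<omega> j = b} | j b. - int n \<le> j \<and> j < 0}"
        then obtain j b where A: "A = {\<omega>. \<omega> j = b}" "- int n \<le> j" "j < 0" by auto
        then have "(lshift ^^ n) -` A = word n -` {s. s ! nat (j + int n) = b} \<inter> space V"
          by (auto simp: lshift_funpow spV nth_word)
        also have "\<dots> \<in> sets V" by (rule measurable_sets[OF wV]) simp
        also have "sets V \<subseteq> sets (null_extension M V)"
          using subalgebra_null_extension(2)[OF V(1)] unfolding subalgebra_def by (rule conjunct2)
        finally show ?thesis .
      next
        assume "A \<in> D"
        then have A: "(lshift ^^ n) -` A \<in> D" by (rule vim)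
        then obtain C where C: "C \<in> sets B" "AE x in M. x \<in> (lshift ^^ n) -` A \<longleftrightarrow> \<alpha> x \<in> C"
          using gen1 by blast
        show ?thesis
        proof (rule in_null_extensionI[OF V(1)])
          show "(lshift ^^ n) -` A \<in> sets M" using A D_sub unfolding sets by (rule rev_subsetD)
          show "\<alpha> -` C \<inter> space V \<in> sets V" by (rule measurable_sets[OF aV C(1)])
          show "AE x in M. x \<in> (lshift ^^ n) -` A \<longleftrightarrow> x \<in> \<alpha> -` C \<inter> space V"
            using C(2) by eventually_elim (simp add: spV)
        qed
      qed
      then have "{(lshift ^^ n) -` A | A. A \<in> {{\<omega>. \<omega> j = b} | j b. - int n \<le> j \<and> j < 0} \<union> D}
          \<subseteq> sets (null_extension M V)"
        by (intro subsetI) (elim CollectE exE conjE, simp only:)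
      from sets.sigma_sets_subset[OF this] show ?thesis unfolding setsG' by (simp add: sp)
    qed
    have "AE x in M. real_cond_exp M G' (indicator {x. x (int n) = a}) x = real_cond_exp M V (indicator {x. x (int n) = a}) x"
      by (rule real_cond_exp_cong_null[OF G'(1) V(1) iT G'V VG'])
    with G'(2) V(2) show ?thesis unfolding fT e_def by eventually_elim simp
  qed
  \<comment> \<open>Maker's theorem is stated with an everywhere bound, while these conditional
    expectations lie in [0,1] only almost everywhere. Truncation at 1 supplies the bound, and
    \<open>le1\<close> removes it along almost every orbit.\<close>
  have "AE x in M. (\<lambda>N. (\<Sum>n<N. min 1 \<bar>e n ((lshift ^^ n) x) - h ((lshift ^^ n) x)\<bar>) / real N) \<longlonglongrightarrow> 0"
  proof (rule maker_ergodic_zero[OF T inv, where C=1 and f="\<lambda>n x. min 1 \<bar>e n x - h x\<bar>"])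
    show "AE x in M. (\<lambda>n. min 1 \<bar>e n x - h x\<bar>) \<longlonglongrightarrow> 0"
      using levy
    proof eventually_elim
      case (elim x)
      have "(\<lambda>n. min 1 \<bar>e n x - h x\<bar>) \<longlonglongrightarrow> min 1 \<bar>h x - h x\<bar>"
        by (intro tendsto_intros elim)
      then show ?case by simp
    qed
  qed auto
  moreover have "AE x in M. \<forall>n. \<bar>e n ((lshift ^^ n) x) - h ((lshift ^^ n) x)\<bar> \<le> 1"
    unfolding AE_all_countable using le1 by blast
  moreover have "AE x in M. \<forall>n. e n ((lshift ^^ n) x) = cond_next (K (\<alpha> x)) x n a"
    unfolding AE_all_countable using ident by blast
  ultimately show ?thesis
    unfolding f_def[symmetric] P_def[symmetric] h_def[symmetric]
    by eventually_elim (simp add: min_absorb2)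
qed

section \<open>Weak learnability\<close>

lemma pred_dist_nonneg: "0 \<le> pred_dist M N \<omega> n"
  unfolding pred_dist_def by (subst Max_ge_iff) auto

text \<open>Replacing the maximum over letters by a sum and passing through a common reference
  \<open>c\<close> reduces the distance to separate tracking statements, one for each letter and
  each measure.\<close>

lemma pred_dist_le_sum:
  fixes M :: "(int \<Rightarrow> 'a::finite) measure"
  shows "pred_dist M N \<omega> n \<le> (\<Sum>a\<in>UNIV. \<bar>cond_next M \<omega> n a - c a\<bar> + \<bar>cond_next N \<omega> n a - c a\<bar>)"
  unfolding pred_dist_def
proof (subst Max_le_iff, simp_all, intro allI)
  fix b :: 'a
  have "\<bar>cond_next M \<omega> n b - cond_next N \<omega> n b\<bar> \<le> \<bar>cond_next M \<omega> n b - c b\<bar> + \<bar>cond_next N \<omega> n b - c b\<bar>"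
    by linarith
  also have "\<dots> \<le> (\<Sum>a\<in>UNIV. \<bar>cond_next M \<omega> n a - c a\<bar> + \<bar>cond_next N \<omega> n a - c a\<bar>)"
    by (rule member_le_sum) auto
  finally show "\<bar>cond_next M \<omega> n b - cond_next N \<omega> n b\<bar> \<le> \<dots>" .
qed

lemma strong_cesaro_pred_dist:
  fixes M :: "(int \<Rightarrow> 'a::finite) measure"
  assumes "\<And>a. (\<lambda>N. (\<Sum>n<N. \<bar>cond_next M \<omega> n a - c n a\<bar>) / real N) \<longlonglongrightarrow> 0"
    and "\<And>a. (\<lambda>N. (\<Sum>n<N. \<bar>cond_next M' \<omega> n a - c n a\<bar>) / real N) \<longlonglongrightarrow> 0"
  shows "strong_cesaro (pred_dist M M' \<omega>) 0"
  unfolding strong_cesaro_def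
proof (rule tendsto_sandwich[OF _ _ tendsto_const])
  let ?b = "\<lambda>N. \<Sum>a\<in>UNIV. (\<Sum>n<N. \<bar>cond_next M \<omega> n a - c n a\<bar>) / real N + (\<Sum>n<N. \<bar>cond_next M' \<omega> n a - c n a\<bar>) / real N"
  have "?b \<longlonglongrightarrow> (\<Sum>a\<in>(UNIV :: 'a set). 0 + 0)" by (intro tendsto_intros assms)
  then show "?b \<longlonglongrightarrow> 0" by simp
  show "\<forall>\<^sub>F N in sequentially. 0 \<le> (\<Sum>n<N. \<bar>pred_dist M M' \<omega> n - 0\<bar>) / real N"
    by (auto intro!: divide_nonneg_nonneg sum_nonneg)
  have "(\<Sum>n<N. \<bar>pred_dist M M' \<omega> n - 0\<bar>) / real N \<le> ?b N" for N
  proof -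
    have "(\<Sum>n<N. \<bar>pred_dist M M' \<omega> n - 0\<bar>) / real N
        \<le> (\<Sum>n<N. \<Sum>a\<in>UNIV. \<bar>cond_next M \<omega> n a - c n a\<bar> + \<bar>cond_next M' \<omega> n a - c n a\<bar>) / real N"
      by (intro divide_right_mono sum_mono) (simp_all add: abs_of_nonneg pred_dist_nonneg pred_dist_le_sum)
    also have "\<dots> = ?b N"
      by (subst sum.swap) (simp add: sum.distrib sum_divide_distrib add_divide_distrib)
    finally show ?thesis .
  qed
  then show "\<forall>\<^sub>F N in sequentially. (\<Sum>n<N. \<bar>pred_dist M M' \<omega> n - 0\<bar>) / real N \<le> ?b N" by simp
qed

theorem theorem2:
  fixes \<mu> :: "(int \<Rightarrow> 'a::finite) measure"
    and D :: "(int \<Rightarrow> 'a) set set"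
    and \<alpha> :: "(int \<Rightarrow> 'a) \<Rightarrow> 'b::polish_space"
    and K :: "'b \<Rightarrow> (int \<Rightarrow> 'a) measure"
  assumes prob: "prob_space \<mu>"
    and sets_mu: "sets \<mu> = sets shift_space"
    and stationary: "distr \<mu> shift_space lshift = \<mu>"
    and D_sigma: "sigma_algebra (space shift_space) D"
    and D_sub: "D \<subseteq> sets shift_space"
    and D_inv: "\<forall>S \<in> sets shift_space. S \<in> D \<longleftrightarrow> lshift ` S \<in> D"
    and D_past: "D \<subseteq> past_sets"
    and alpha_meas: "\<alpha> \<in> measurable shift_space borel"
    and alpha_gen1: "\<forall>E \<in> D. \<exists>B \<in> sets borel.
                        emeasure \<mu> (E \<union> (\<alpha> -` B \<inter> space \<mu>) - E \<inter> (\<alpha> -` B \<inter> space \<mu>)) = 0"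
    and alpha_gen2: "\<forall>B \<in> sets borel. \<exists>E \<in> D.
                        emeasure \<mu> (E \<union> (\<alpha> -` B \<inter> space \<mu>) - E \<inter> (\<alpha> -` B \<inter> space \<mu>)) = 0"
    and K_prob: "\<forall>\<theta>. prob_space (K \<theta>)"
    and K_sets: "\<forall>\<theta>. sets (K \<theta>) = sets shift_space"
    and K_conc: "\<forall>\<theta>. emeasure (K \<theta>) {\<omega> \<in> space shift_space. \<alpha> \<omega> = \<theta>} = 1"
    and K_meas: "\<forall>S \<in> sets shift_space. (\<lambda>\<theta>. emeasure (K \<theta>) S) \<in> borel_measurable borel"
    and K_disint: "\<forall>S \<in> sets shift_space.
                     emeasure \<mu> S = (\<integral>\<^sup>+ \<theta>. emeasure (K \<theta>) S \<partial>(distr \<mu> borel \<alpha>))"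
  shows "AE \<theta> in distr \<mu> borel \<alpha>. AE \<omega> in K \<theta>. strong_cesaro (pred_dist \<mu> (K \<theta>) \<omega>) 0"
proof -
  interpret prob_space \<mu> by (rule prob)
  have sp: "space \<mu> = UNIV" using sets_eq_imp_space_eq[OF sets_mu] by simp
  have inv: "distr \<mu> \<mu> lshift = \<mu>"
    using stationary by (simp add: sets_mu cong: distr_cong)
  have \<alpha>: "\<alpha> \<in> measurable \<mu> borel" using alpha_meas by (simp cong: measurable_cong_sets add: sets_mu)
  define L where "L = distr \<mu> borel \<alpha>"
    have AE_\<alpha>: "AE x in K \<theta>. \<alpha> x = \<theta>" for \<theta>
  proof -
    interpret K: prob_space "K \<theta>" using K_prob by blast
    have "K.prob {\<omega> \<in> space shift_space. \<alpha> \<omega> = \<theta>} = 1" using K_conc by (simp add: measure_def)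
    from K.AE_prob_1[OF this] show ?thesis by simp
  qed
  have vS: "\<alpha> -` C \<in> sets shift_space" if "C \<in> sets borel" for C
    using measurable_sets[OF alpha_meas that] by simp
  \<comment> \<open>Concentration of \<open>K \<theta>\<close> on the fibre over \<theta> makes
    intersection with the preimage of \<open>C\<close> act as multiplication by the indicator of
    \<open>C\<close> at \<theta>. Thus the formula for \<mu> of a single set becomes a
    disintegration jointly with \<alpha>.\<close>
  have dis: "emeasure \<mu> (S \<inter> (\<alpha> -` C \<inter> space \<mu>)) = (\<integral>\<^sup>+\<theta>\<in>C. emeasure (K \<theta>) S \<partial>L)"
    if S: "S \<in> sets shift_space" and C: "C \<in> sets borel" for S C
  proof -
    have SC: "S \<inter> \<alpha> -` C \<in> sets shift_space" using S vS[OF C] by blast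
    have "emeasure (K \<theta>) (S \<inter> \<alpha> -` C) = emeasure (K \<theta>) S * indicator C \<theta>" for \<theta>
    proof (cases "\<theta> \<in> C")
      case True
      have "emeasure (K \<theta>) (S \<inter> \<alpha> -` C) = emeasure (K \<theta>) S"
        by (rule emeasure_eq_AE) (use AE_\<alpha>[of \<theta>] True S SC K_sets in \<open>auto elim!: eventually_mono\<close>)
      with True show ?thesis by simp
    next
      case False
      have "emeasure (K \<theta>) (S \<inter> \<alpha> -` C) = emeasure (K \<theta>) {}"
        by (rule emeasure_eq_AE) (use AE_\<alpha>[of \<theta>] False SC K_sets in \<open>auto elim!: eventually_mono\<close>)
      with False show ?thesis by simp
    qed
    with K_disint SC show ?thesis by (simp add: sp L_def)
  qed
  have sym: "AE x in \<mu>. x \<in> E \<longleftrightarrow> \<alpha> x \<in> C"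
    if "E \<in> D" "C \<in> sets borel"
      "emeasure \<mu> (E \<union> (\<alpha> -` C \<inter> space \<mu>) - E \<inter> (\<alpha> -` C \<inter> space \<mu>)) = 0" for E C
  proof -
    have "E \<union> (\<alpha> -` C \<inter> space \<mu>) - E \<inter> (\<alpha> -` C \<inter> space \<mu>) \<in> null_sets \<mu>"
      using that vS[of C] D_sub by (auto simp: null_sets_def sets_mu sp)
    from AE_not_in[OF this] show ?thesis by eventually_elim (auto simp: sp)
  qed
  have D_image: "lshift ` E \<in> D" if "E \<in> D" for E using D_inv D_sub that by blast
  \<comment> \<open>\<open>D_inv\<close> speaks of images; it is applied to the preimage of
    \<open>E\<close>, whose image is \<open>E\<close> again by surjectivity of the shift.\<close>
  have D_vimage: "lshift -` E \<in> D" if "E \<in> D" for E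
  proof -
    have "lshift -` E \<in> sets shift_space" using measurable_sets[OF measurable_lshift, of E] D_sub that by auto
    moreover have "lshift ` (lshift -` E) = E" by (rule surj_image_vimage_eq[OF bij_is_surj[OF bij_lshift]])
    ultimately show ?thesis using D_inv that by metis
  qed
  define h where "h a n x = real_cond_exp \<mu> (sigma UNIV past_sets) (indicator {x. x 0 = a}) ((lshift ^^ n) x)"
    for a n and x :: "int \<Rightarrow> 'a"
  have 1: "AE x in \<mu>. (\<lambda>N. (\<Sum>n<N. \<bar>cond_next (K (\<alpha> x)) x n a - h a n x\<bar>) / real N) \<longlonglongrightarrow> 0" for a
    unfolding h_def
  proof (rule prediction_tracks_infinite_past[OF prob sets_mu inv D_sub D_past D_vimage D_image \<alpha>])
    show "\<exists>C\<in>sets borel. AE x in \<mu>. x \<in> E \<longleftrightarrow> \<alpha> x \<in> C" if "E \<in> D" for E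
      using alpha_gen1 sym that by blast
    show "\<exists>E\<in>D. AE x in \<mu>. x \<in> E \<longleftrightarrow> \<alpha> x \<in> C" if "C \<in> sets borel" for C
      using alpha_gen2 sym that by blast
  qed (use K_prob K_sets K_meas dis in \<open>auto simp: L_def\<close>)
  \<comment> \<open>The constant kernel \<mu> over a one-point quotient disintegrates \<mu> along
    the trivial algebra. The reference sequence \<open>h\<close> is literally the one in
    \<open>1\<close>.\<close>
  have 2: "AE x in \<mu>. (\<lambda>N. (\<Sum>n<N. \<bar>cond_next \<mu> x n a - h a n x\<bar>) / real N) \<longlonglongrightarrow> 0" for a
    unfolding h_def
  proof (rule prediction_tracks_infinite_past[where D="{{}, UNIV}" and B="count_space (UNIV :: unit set)"
        and \<alpha>="\<lambda>_. ()" and K="\<lambda>_. \<mu>", OF prob sets_mu inv])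
    show "{{}, UNIV} \<subseteq> sets shift_space" using sets.top[of shift_space] by auto
    show "{{}, UNIV} \<subseteq> past_sets" unfolding past_sets_eq by (auto intro: sigma_sets.Empty sigma_sets_top)
    show "lshift -` E \<in> {{}, UNIV}" "lshift ` E \<in> {{}, UNIV}" if "E \<in> {{}, UNIV}" for E :: "(int \<Rightarrow> 'a) set"
      using that bij_is_surj[OF bij_lshift] by auto
    show "\<exists>C\<in>sets (count_space UNIV). AE x in \<mu>. x \<in> E \<longleftrightarrow> () \<in> C" if "E \<in> {{}, UNIV}" for E
      using that by (intro bexI[of _ "if E = {} then {} else UNIV"]) auto
    show "\<exists>E\<in>{{}, UNIV}. AE x in \<mu>. x \<in> E \<longleftrightarrow> () \<in> C" for C
      by (cases "() \<in> C") auto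
    show "emeasure \<mu> (S \<inter> ((\<lambda>_. ()) -` C \<inter> space \<mu>))
        = (\<integral>\<^sup>+\<theta>\<in>C. emeasure \<mu> S \<partial>distr \<mu> (count_space UNIV) (\<lambda>_. ()))" for S C
      by (cases "() \<in> C")
         (auto simp: nn_integral_cmult_indicator emeasure_distr sp emeasure_space_1[unfolded sp] vimage_def)
  qed (auto simp: prob sets_mu)
  have "AE x in \<mu>. \<forall>a. (\<lambda>N. (\<Sum>n<N. \<bar>cond_next (K (\<alpha> x)) x n a - h a n x\<bar>) / real N) \<longlonglongrightarrow> 0"
    "AE x in \<mu>. \<forall>a. (\<lambda>N. (\<Sum>n<N. \<bar>cond_next \<mu> x n a - h a n x\<bar>) / real N) \<longlonglongrightarrow> 0"
    unfolding AE_all_countable using 1 2 by blast+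
  then have "AE x in \<mu>. strong_cesaro (pred_dist \<mu> (K (\<alpha> x)) x) 0"
  proof eventually_elim
    case (elim x)
    then show ?case by (intro strong_cesaro_pred_dist[where c="\<lambda>n a. h a n x"]) auto
  qed
  then obtain N where N: "{x \<in> space \<mu>. \<not> strong_cesaro (pred_dist \<mu> (K (\<alpha> x)) x) 0} \<subseteq> N"
    "emeasure \<mu> N = 0" "N \<in> sets \<mu>" by (rule AE_E)
  \<comment> \<open>The measurable null cover \<open>N\<close> of the exceptional set is
    disintegrated, so it is null for almost every \<open>K \<theta>\<close>. Under such a
    \<open>K \<theta>\<close>, almost surely \<open>\<alpha> x = \<theta>\<close>, which turns
    \<open>K (\<alpha> x)\<close> into \<open>K \<theta>\<close>.\<close>
  have "(\<integral>\<^sup>+\<theta>. emeasure (K \<theta>) N \<partial>L) = 0" using K_disint N sets_mu unfolding L_def by metis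
  then have "AE \<theta> in L. emeasure (K \<theta>) N = 0"
    using K_meas N(3) sets_mu by (subst (asm) nn_integral_0_iff_AE) (auto simp: L_def)
  then show ?thesis unfolding L_def[symmetric]
  proof eventually_elim
    case (elim \<theta>)
    have "AE x in K \<theta>. x \<notin> N"
      using elim N(3) K_sets sets_mu by (intro AE_not_in) (simp add: null_sets_def)
    then show ?case using AE_\<alpha>[of \<theta>] by eventually_elim (use N(1) sp in auto)
  qed
qed

end
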